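(* Let $n\ge 1$ and let $k_1,\dots,k_I$ be positive integers with $k_1+\cdots+k_I=n$. In the set of unitary matrices of order $n$, the real codimension of the subset of those having exactly $I$ distinct eigenvalues with multiplicities $k_1,\dots,k_I$ is $$\sum_{i=1}^I (k_i^2-1).$$
   Context: A complex $n\times n$ matrix $A$ is unitary if $AA^\ast$ is the identity, where $A^\ast$ is the adjoint (conjugate transpose). The set of unitary matrices of order $n$ has real dimension $n^2$. "Real dimension" of a subset is the usual dimension over $\mathbb R$ (of a real manifold, or of a semialgebraic set), and the real codimension is $n^2$ minus the real dimension of the subset. The values of the eigenvalues are not prescribed. *)

theory Defs
  imports "HOL-Analysis.Analysis" "HOL-Computational_Algebra.Polynomial"
begin

definition conj_transpose :: "complex^'n^'m \<Rightarrow> complex^'m^'n" where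
  "conj_transpose A = map_matrix cnj (transpose A)"

definition unitary_matrices :: "(complex^'n^'n) set" where
  "unitary_matrices = {A. A ** conj_transpose A = mat 1}"

definition eigenvalues :: "complex^'n^'n \<Rightarrow> complex set" where
  "eigenvalues A = {c. \<exists>v. v \<noteq> 0 \<and> A *v v = c *s v}"

definition charpoly :: "complex^'n^'n \<Rightarrow> complex poly" where
  "charpoly A = det (mat [:0, 1:] - map_matrix (\<lambda>c. [:c:]) A)"

definition multiplicity_of :: "complex^'n^'n \<Rightarrow> complex \<Rightarrow> nat" where
  "multiplicity_of A c = order c (charpoly A)"

text \<open>The numbering of the eigenvalues is existentially quantified, so only the multiset of the
  multiplicities matters, and the values of the eigenvalues are free.\<close>

definition has_eigenvalue_multiplicities :: "complex^'n^'n \<Rightarrow> nat \<Rightarrow> (nat \<Rightarrow> nat) \<Rightarrow> bool" where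
  "has_eigenvalue_multiplicities A m k \<longleftrightarrow>
     (\<exists>c. inj_on c {1..m} \<and> eigenvalues A = c ` {1..m} \<and>
          (\<forall>i\<in>{1..m}. multiplicity_of A (c i) = k i))"

text \<open>\<open>S\<close> is a nonempty real manifold of dimension \<open>d\<close>: every point has a relatively open
  neighbourhood homeomorphic to an open subset of \<open>d\<close>-dimensional Euclidean space (the Hausdorff
  and countability conditions are automatic for subsets of a Euclidean space). The set is required
  to be nonempty because the empty set satisfies the local condition for every \<open>d\<close>; with
  it, \<open>d\<close> is unique by invariance of dimension. The space \<open>complex^'n^'n\<close> is
  used with its real Euclidean structure.\<close>

definition has_real_dimension :: "'a::euclidean_space set \<Rightarrow> nat \<Rightarrow> bool" where
  "has_real_dimension S d \<longleftrightarrow> S \<noteq> {} \<and>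
     (\<forall>x\<in>S. \<exists>U W. openin (top_of_set S) U \<and> x \<in> U \<and> openin (Euclidean_space d) W \<and>
        top_of_set U homeomorphic_space subtopology (Euclidean_space d) W)"

definition has_real_codimension_in :: "'a::euclidean_space set \<Rightarrow> 'a set \<Rightarrow> int \<Rightarrow> bool" where
  "has_real_codimension_in S M c \<longleftrightarrow> S \<subseteq> M \<and>
     (\<exists>m d. has_real_dimension M m \<and> has_real_dimension S d \<and> c = int m - int d)"

end

(* A stratum point is conjugate, by a unitary matrix, to D = diag delta; let the blocks be the level
   sets of delta. Write t as X + E with X off-block and E block-diagonal. The map
   t |-> (1 + X) (D (1 + E)) (1 + X)^-1 is injective near 0, since an intertwiner of two block-diagonal
   matrices with separated spectra is block-diagonal; so by invariance of domain it is a chart of the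
   whole matrix space, and no inverse function theorem is needed. In this chart the stratum is given by:
   E is scalar on every block, |1 + E| = 1, and (1 + X)^* (1 + X) is block-diagonal. The quadratic
   perturbation of the identity t + beta t t turns these conditions into linear ones. The unitary
   group itself is treated in the same way, with t + t^* t / 2. *)
theory Submission
  imports Defs "HOL-Computational_Algebra.Fundamental_Theorem_Algebra"
begin

section \<open>Dimension from straightening coordinates\<close>

text \<open>Invariance of domain compares open sets of one and the same space, so the coordinates
  must fill the whole matrix space. The obstacle is that the stratum is not given by equations but
  by a pattern of coincidences among eigenvalues. Near D the eigenvalues of different blocks stay
  apart, so a matrix with as many distinct eigenvalues as D has exactly one per block, and a
  diagonalizable block with one eigenvalue is scalar. The quadratic correction comes from the
  expansions 1 + X + X^* + X^* X and |1 + z|^2 = 1 + 2 Re z + |z|^2: their quadratic terms are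
  Hermitian or real, so one half of each can be absorbed into the coordinate. The count: every
  unordered pair of indices from different blocks leaves one complex parameter and every block one
  phase, which gives n^2 - sum k_i^2 + I. With singleton blocks this is n^2, the dimension of the
  unitary group.\<close>

lemma homeomorphic_Euclidean_space_subspace:
  fixes L :: "'a::euclidean_space set"
  assumes L: "subspace L" "dim L = d" and U: "openin (top_of_set L) U"
  shows "\<exists>W. openin (Euclidean_space d) W \<and>
             top_of_set U homeomorphic_space subtopology (Euclidean_space d) W"
proof -
  obtain B where B: "B \<subseteq> L" "pairwise orthogonal B" "\<And>x. x \<in> B \<Longrightarrow> norm x = 1"
      "independent B" "card B = d" "span B = L"
    using orthonormal_basis_subspace[OF L(1)] L(2) by metis
  have "finite B" using B(4) independent_imp_finite by blast
  then obtain e where e: "bij_betw e {..<d} B"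
    using B(5) by (metis ex_bij_betw_nat_finite lessThan_atLeast0)
  have eB: "e i \<in> B" if "i < d" for i
    using e that by (auto simp: bij_betw_def)
  have ee: "e i \<bullet> e j = (if i = j then 1 else 0)" if "i < d" "j < d" for i j
  proof (cases "i = j")
    case True
    then show ?thesis using B(3)[OF eB[OF that(1)]] by (simp add: dot_square_norm)
  next
    case False
    then have "e i \<noteq> e j" using e that by (auto simp: bij_betw_def inj_on_def)
    then show ?thesis using B(2) eB that False by (auto simp: pairwise_def orthogonal_def)
  qed
  \<comment> \<open>Points of \<open>Euclidean_space d\<close> are infinite sequences that vanish
    from index \<open>d\<close> on, hence the padding by 0.\<close>
  define f where "f = (\<lambda>x::'a. \<lambda>i. if i < d then x \<bullet> e i else 0)"
  define g where "g = (\<lambda>y::nat \<Rightarrow> real. \<Sum>i<d. y i *\<^sub>R e i)"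
  define W where "W = {y \<in> topspace (Euclidean_space d). g y \<in> U}"
  have UL: "U \<subseteq> L" using U openin_imp_subset by blast
  have gL: "g y \<in> L" for y
    unfolding g_def using B(1) eB by (intro subspace_sum[OF L(1)] subspace_scale[OF L(1)]) auto
  have cg: "continuous_map (Euclidean_space d) (top_of_set L) g"
    unfolding continuous_map_in_subtopology continuous_map_Euclidean_space_iff
    using gL unfolding g_def by (auto intro!: continuous_intros continuous_on_product_coordinates[THEN continuous_on_subset])
  have cf: "continuous_map (top_of_set L) (Euclidean_space d) f"
    unfolding f_def continuous_map_componentwise_Euclidean_space
    by (auto simp: continuous_map_iff_continuous2 intro!: continuous_intros)
  have fg: "f (g y) = y" if "y \<in> topspace (Euclidean_space d)" for y
    using that by (auto simp: f_def g_def topspace_Euclidean_space fun_eq_iff inner_sum_left ee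
        if_distrib[of "\<lambda>z. _ * z"] sum.delta' cong: if_cong)
  have gf: "g (f x) = x" if "x \<in> L" for x
  proof -
    have "x \<in> span B" using that B(6) by simp
    then have "x = (\<Sum>b\<in>B. (x \<bullet> b) *\<^sub>R b)"
    proof (induction rule: span_induct_alt)
      case base
      then show ?case by simp
    next
      case (step c b y)
      have "(\<Sum>a\<in>B. (b \<bullet> a) *\<^sub>R a) = (\<Sum>a\<in>B. if a = b then b else 0)"
        using B(2,3) step(1) 
        by (intro sum.cong) (auto simp: pairwise_def orthogonal_def dot_square_norm)
      then have "(\<Sum>a\<in>B. (b \<bullet> a) *\<^sub>R a) = b"
        using \<open>finite B\<close> step(1) by simp
      moreover have "(\<Sum>a\<in>B. ((c *\<^sub>R b + y) \<bullet> a) *\<^sub>R a) =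
          c *\<^sub>R (\<Sum>a\<in>B. (b \<bullet> a) *\<^sub>R a) + (\<Sum>a\<in>B. (y \<bullet> a) *\<^sub>R a)"
        by (simp add: inner_left_distrib scaleR_left_distrib sum.distrib scaleR_sum_right)
      ultimately show ?case using step(2) by simp
    qed
    also have "\<dots> = (\<Sum>i<d. (x \<bullet> e i) *\<^sub>R e i)"
      using sum.reindex_bij_betw[OF e, of "\<lambda>b. (x \<bullet> b) *\<^sub>R b"] by simp
    finally show ?thesis by (simp add: f_def g_def)
  qed
  have "openin (Euclidean_space d) W"
    unfolding W_def using cg U by (rule openin_continuous_map_preimage)
  moreover have "homeomorphic_maps (top_of_set U) (subtopology (Euclidean_space d) W) f g"
    unfolding homeomorphic_maps_def
  proof (intro conjI ballI)
    have *: "continuous_map (top_of_set U) (Euclidean_space d) f"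
      using continuous_map_from_subtopology[OF cf, of U] UL by (simp add: subtopology_subtopology Int_absorb1)
    have f1: "f x \<in> W" if "x \<in> U" for x
      using * that gf UL by (auto simp: W_def continuous_map_def)
    show "continuous_map (top_of_set U) (subtopology (Euclidean_space d) W) f"
      using * f1 by (simp add: continuous_map_in_subtopology)
    show "continuous_map (subtopology (Euclidean_space d) W) (top_of_set U) g"
      using continuous_map_from_subtopology[OF cg, of W]
      by (auto simp: continuous_map_in_subtopology W_def)
    show "g (f x) = x" if "x \<in> topspace (top_of_set U)" for x
      using that gf UL by auto
    show "f (g y) = y" if "y \<in> topspace (subtopology (Euclidean_space d) W)" for y
      using that fg by auto
  qed
  ultimately show ?thesis unfolding homeomorphic_space_def by blast
qed

text \<open>Both \<open>\<Theta>\<close> and \<open>f\<close> map an open set continuously and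
  injectively into a space of the same dimension, so each is a homeomorphism onto an open image. The
  part \<open>T\<close> of \<open>N\<close> lying over \<open>S\<close> is then homeomorphic through
  \<open>\<Theta>\<close> to an open piece of \<open>S\<close> and through \<open>f\<close> to an
  open piece of \<open>L\<close>. Differentiability never enters.\<close>

lemma has_real_dimension_if_straightened:
  fixes S :: "'a::euclidean_space set"
  assumes "S \<noteq> {}"
    and chart: "\<And>A. A \<in> S \<Longrightarrow> \<exists>N \<Theta> (f :: 'a \<Rightarrow> 'a) L. open N \<and>
          continuous_on N \<Theta> \<and> inj_on \<Theta> N \<and> A \<in> \<Theta> ` N \<and>
          continuous_on N f \<and> inj_on f N \<and> subspace L \<and> dim L = d \<and>
          (\<forall>t\<in>N. \<Theta> t \<in> S \<longleftrightarrow> f t \<in> L)"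
  shows "has_real_dimension S d"
  unfolding has_real_dimension_def
proof (intro conjI ballI)
  show "S \<noteq> {}" by fact
  fix A assume "A \<in> S"
  from chart[OF this] show "\<exists>U W. openin (top_of_set S) U \<and> A \<in> U \<and> openin (Euclidean_space d) W \<and>
        top_of_set U homeomorphic_space subtopology (Euclidean_space d) W"
  proof (elim exE conjE)
    fix N L and \<Theta> f :: "'a \<Rightarrow> 'a"
    assume N: "open N" "continuous_on N \<Theta>" "inj_on \<Theta> N" "A \<in> \<Theta> ` N"
        "continuous_on N f" "inj_on f N" and L: "subspace L" "dim L = d"
      and eq: "\<forall>t\<in>N. \<Theta> t \<in> S \<longleftrightarrow> f t \<in> L"
    obtain \<Theta>' where h: "homeomorphism N (\<Theta> ` N) \<Theta> \<Theta>'"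
      using invariance_of_domain_homeomorphism[OF N(1,2) _ N(3)] by auto
    obtain f' where h': "homeomorphism N (f ` N) f f'"
      using invariance_of_domain_homeomorphism[OF N(1,5) _ N(6)] by auto
    have op: "open (\<Theta> ` N)" "open (f ` N)"
      using N invariance_of_domain by blast+
    define U V where "U = S \<inter> \<Theta> ` N" and "V = L \<inter> f ` N"
    define T where "T = {t \<in> N. f t \<in> L}"
    have T: "T \<subseteq> N" by (auto simp: T_def)
    have 1: "\<Theta> ` T = U" using eq by (auto simp: T_def U_def)
    have 2: "f ` T = V" by (auto simp: T_def V_def)
    have "homeomorphism T U \<Theta> \<Theta>'" "homeomorphism T V f f'"
      using homeomorphism_of_subsets[OF h T _ 1] homeomorphism_of_subsets[OF h' T _ 2] T 1 2
      by auto
    then have "U homeomorphic V"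
      by (meson homeomorphic_def homeomorphic_sym homeomorphic_trans)
    then obtain p q where pq: "homeomorphism U V p q" unfolding homeomorphic_def by blast
    then have "homeomorphic_maps (top_of_set U) (top_of_set V) p q"
      by (auto simp: homeomorphic_maps_def homeomorphism_def)
    then have UV: "top_of_set U homeomorphic_space top_of_set V"
      unfolding homeomorphic_space_def by blast
    have "openin (top_of_set L) V" using op(2) by (simp add: V_def openin_open_Int)
    then obtain W where "openin (Euclidean_space d) W"
        "top_of_set V homeomorphic_space subtopology (Euclidean_space d) W"
      using homeomorphic_Euclidean_space_subspace[OF L] by blast
    moreover have "openin (top_of_set S) U" using op(1) by (simp add: U_def openin_open_Int)
    moreover have "A \<in> U" using \<open>A \<in> S\<close> N(4) by (simp add: U_def)
    ultimately show ?thesis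
      using UV homeomorphic_space_trans by blast
  qed
qed

text \<open>Near the origin the quadratic term is a small perturbation of the identity.\<close>

lemma inj_on_add_quadratic:
  assumes "bounded_bilinear \<beta>"
  obtains \<epsilon> where "\<epsilon> > 0" "inj_on (\<lambda>t. t + \<beta> t t) (ball 0 \<epsilon>)"
proof -
  interpret bounded_bilinear \<beta> by fact
  obtain K where K: "K > 0" "\<And>a b. norm (\<beta> a b) \<le> norm a * norm b * K"
    using pos_bounded by blast
  \<comment> \<open>The difference of the quadratic terms at \<open>s\<close> and \<open>t\<close>
    is at most \<open>(norm t + norm s) * K\<close> times \<open>norm (s - t)\<close>; this radius
    makes the factor smaller than 1.\<close>
  define e where "e = 1 / (2 * K)"
  have "inj_on (\<lambda>t. t + \<beta> t t) (ball 0 e)"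
  proof (rule inj_onI, rule ccontr)
    fix s t assume st: "s \<in> ball 0 e" "t \<in> ball 0 e" "s + \<beta> s s = t + \<beta> t t" "s \<noteq> t"
    have "s - t = \<beta> t t - \<beta> s s" using st(3) by (simp add: algebra_simps)
    also have "\<dots> = - \<beta> t (s - t) - \<beta> (s - t) s"
      by (simp add: diff_left diff_right)
    finally have "norm (s - t) \<le> norm (\<beta> t (s - t)) + norm (\<beta> (s - t) s)"
      by (metis norm_minus_cancel norm_triangle_ineq4)
    also have "\<dots> \<le> norm t * norm (s - t) * K + norm (s - t) * norm s * K"
      using K(2) by (intro add_mono)
    also have "\<dots> = (norm t + norm s) * K * norm (s - t)" by (simp add: algebra_simps)
    also have "\<dots> < 2 * e * K * norm (s - t)"
      using st K(1) by (intro mult_strict_right_mono) auto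
    also have "\<dots> = norm (s - t)" using K(1) by (simp add: e_def)
    finally show False by simp
  qed
  moreover have "e > 0" using K(1) by (simp add: e_def)
  ultimately show thesis using that by blast
qed

section \<open>Diagonalization of unitary matrices\<close>

definition hinner :: "complex^'n \<Rightarrow> complex^'n \<Rightarrow> complex" where
  "hinner u v = (\<Sum>i\<in>UNIV. cnj (u $ i) * v $ i)"

definition diag_matrix :: "('n \<Rightarrow> complex) \<Rightarrow> complex^'n^'n" where
  "diag_matrix d = (\<chi> i j. if i = j then d i else 0)"

section \<open>Algebra of adjoints and of the Hermitian form\<close>

lemma conj_transpose_nth [simp]: "conj_transpose A $ i $ j = cnj (A $ j $ i)"
  by (simp add: conj_transpose_def transpose_def)

lemma conj_transpose_mult: "conj_transpose (A ** B) = conj_transpose B ** conj_transpose A"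
  by (simp add: vec_eq_iff matrix_matrix_mult_def mult.commute)

lemma conj_transpose_conj_transpose [simp]: "conj_transpose (conj_transpose A) = A"
  by (simp add: vec_eq_iff)

lemma conj_transpose_mat_1 [simp]: "conj_transpose (mat 1) = mat 1"
  by (auto simp: vec_eq_iff mat_def)

lemma conj_transpose_add: "conj_transpose (A + B) = conj_transpose A + conj_transpose B"
  by (simp add: vec_eq_iff)

lemma conj_transpose_scaleR: "conj_transpose (r *\<^sub>R A) = r *\<^sub>R conj_transpose A"
  by (simp add: vec_eq_iff)

lemma unitary_matrices_iff: "A \<in> unitary_matrices \<longleftrightarrow> conj_transpose A ** A = mat 1"
  by (simp add: unitary_matrices_def matrix_left_right_inverse)

lemma unitary_matrices_mult:
  assumes "A \<in> unitary_matrices" "B \<in> unitary_matrices"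
  shows "A ** B \<in> unitary_matrices"
proof -
  have "conj_transpose (A ** B) ** (A ** B) = conj_transpose B ** (conj_transpose A ** A) ** B"
    by (simp add: conj_transpose_mult matrix_mul_assoc)
  then show ?thesis using assms by (simp add: unitary_matrices_iff)
qed

lemma unitary_matrices_conj_transpose:
  "A \<in> unitary_matrices \<Longrightarrow> conj_transpose A \<in> unitary_matrices"
  by (simp add: unitary_matrices_def unitary_matrices_iff matrix_left_right_inverse[of A])

lemma matrix_diff_ldistrib: "A ** (B - C) = A ** B - A ** C"
  for A :: "'a::ring_1^'n^'m"
  by (simp add: vec_eq_iff matrix_matrix_mult_def algebra_simps sum_subtractf)

lemma matrix_diff_rdistrib: "(A - B) ** C = A ** C - B ** C"
  for A :: "'a::ring_1^'n^'m"
  by (simp add: vec_eq_iff matrix_matrix_mult_def algebra_simps sum_subtractf)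

lemma matrix_add_rdistrib: "(A + B) ** C = A ** C + B ** C"
  for A :: "'a::ring_1^'n^'m"
  by (simp add: vec_eq_iff matrix_matrix_mult_def algebra_simps sum.distrib)

lemma hinner_unitary:
  assumes "A \<in> unitary_matrices"
  shows "hinner (A *v u) (A *v v) = hinner u v"
proof -
  have "hinner (A *v u) w = hinner u (conj_transpose A *v w)" for w
  proof -
    have "hinner (A *v u) w = (\<Sum>i\<in>UNIV. \<Sum>j\<in>UNIV. cnj (A $ i $ j) * cnj (u $ j) * w $ i)"
      by (simp add: hinner_def matrix_vector_mult_def sum_distrib_right)
    also have "\<dots> = (\<Sum>j\<in>UNIV. \<Sum>i\<in>UNIV. cnj (A $ i $ j) * cnj (u $ j) * w $ i)"
      by (rule sum.swap)
    also have "\<dots> = hinner u (conj_transpose A *v w)"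
      by (simp add: hinner_def matrix_vector_mult_def sum_distrib_left mult_ac)
    finally show ?thesis .
  qed
  then show ?thesis using assms by (simp add: matrix_vector_mul_assoc unitary_matrices_iff)
qed

lemma hinner_add_right: "hinner u (v + w) = hinner u v + hinner u w"
  by (simp add: hinner_def algebra_simps sum.distrib)

lemma hinner_scale_right: "hinner u (c *s v) = c * hinner u v"
  by (simp add: hinner_def algebra_simps sum_distrib_left)

lemma hinner_scale_left: "hinner (c *s u) v = cnj c * hinner u v"
  by (simp add: hinner_def algebra_simps sum_distrib_left)

lemma cnj_hinner: "cnj (hinner u v) = hinner v u"
  by (simp add: hinner_def mult.commute)

lemma hinner_self: "hinner v v = of_real ((norm v)\<^sup>2)"
  by (simp add: hinner_def norm_vec_def L2_set_def sum_nonneg complex_norm_square[symmetric] mult.commute[of "cnj _"] flip: of_real_power)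

text \<open>The vector p(A) v, computed by Horner's scheme. Acting on a vector keeps every
  intermediate value in an invariant subspace containing \<open>v\<close>.\<close>

definition poly_act :: "complex^'n^'n \<Rightarrow> complex poly \<Rightarrow> complex^'n \<Rightarrow> complex^'n" where
  "poly_act A p v = fold_coeffs (\<lambda>a w. a *s v + A *v w) p 0"

lemma poly_act_0 [simp]: "poly_act A 0 v = 0"
  by (simp add: poly_act_def)

lemma poly_act_pCons [simp]: "poly_act A (pCons a p) v = a *s v + A *v poly_act A p v"
  by (cases "p = 0 \<and> a = 0") (auto simp: poly_act_def)

lemma poly_act_add: "poly_act A (p + q) v = poly_act A p v + poly_act A q v"
  by (induction p q rule: poly_induct2)
     (simp_all add: matrix_vector_right_distrib vec.scale_left_distrib)

lemma poly_act_smult: "poly_act A (smult c p) v = c *s poly_act A p v"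
  by (induction p) (simp_all add: vec.scale_right_distrib vector_smult_assoc vector_scalar_commute)

lemma poly_act_diff: "poly_act A (p - q) v = poly_act A p v - poly_act A q v"
  using poly_act_add[of A "p - q" q v] by simp

lemma poly_act_monom: "poly_act A (monom c i) v = c *s (((*v) A) ^^ i) v"
  by (induction i) (simp_all add: monom_Suc monom_0 vector_scalar_commute)

lemma poly_act_sum: "poly_act A (\<Sum>i\<in>I. p i) v = (\<Sum>i\<in>I. poly_act A (p i) v)"
  by (induction I rule: infinite_finite_induct) (simp_all add: poly_act_add)

text \<open>The iterates of \<open>v\<close> under \<open>A\<close> with exponents 0 to the real
  dimension are one too many to be independent over the reals; a dependence is a polynomial, and
  real coefficients suffice.\<close>

lemma annihilating_polynomial: "\<exists>p. p \<noteq> 0 \<and> poly_act A p v = 0"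
proof -
  define w where "w = (\<lambda>i. (((*v) A) ^^ i) v)"
  define I where "I = {..DIM(complex^'a)}"
  show ?thesis
  \<comment> \<open>Dependence is a property of sets, so repeated iterates are treated apart: they
    are annihilated by a difference of two monomials.\<close>
  proof (cases "inj_on w I")
    case False
    then obtain i j where ij: "i \<noteq> j" "w i = w j" by (auto simp: inj_on_def)
    have "coeff (monom 1 i - monom 1 j :: complex poly) i = 1" using ij by simp
    then have "monom 1 i - monom 1 j \<noteq> (0 :: complex poly)"
      by (metis coeff_0 zero_neq_one)
    moreover have "poly_act A (monom 1 i - monom 1 j) v = 0"
      using ij by (simp add: poly_act_diff poly_act_monom w_def)
    ultimately show ?thesis by blast
  next
    case True
    then have "dependent (w ` I)"
      by (intro dependent_biggerset) (auto simp: I_def card_image)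
    then obtain u x where u: "x \<in> w ` I" "u x \<noteq> 0" "(\<Sum>y\<in>w ` I. u y *\<^sub>R y) = 0"
      by (subst (asm) dependent_finite) (auto simp: I_def)
    then obtain j where j: "j \<in> I" "u (w j) \<noteq> 0" by blast
    define p where "p = (\<Sum>i\<in>I. monom (complex_of_real (u (w i))) i)"
    have "coeff p j \<noteq> 0" using j by (simp add: p_def coeff_sum I_def if_distrib cong: if_cong)
    then have "p \<noteq> 0" by auto
    moreover have "poly_act A p v = (\<Sum>i\<in>I. u (w i) *\<^sub>R w i)"
      unfolding p_def poly_act_sum poly_act_monom w_def
      by (intro sum.cong) (auto simp: vec_eq_iff complex_eq_iff)
    ultimately show ?thesis using u(3) True by (auto simp: sum.reindex)
  qed
qed

text \<open>Split a linear factor x - c off a polynomial p = (x - c) q that annihilates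
  \<open>v\<close>. Either q already annihilates \<open>v\<close>, and the degree has dropped, or
  q(A) v is an eigenvector for c, and it stays in \<open>W\<close> by invariance. The descent must
  stop, since a nonzero constant does not annihilate \<open>v\<close>.\<close>

lemma invariant_subspace_has_eigenvector:
  fixes A :: "complex^'n^'n"
  assumes W: "vec.subspace W" "\<And>x. x \<in> W \<Longrightarrow> A *v x \<in> W"
    and v: "v \<in> W" "v \<noteq> 0"
  shows "\<exists>w c. w \<in> W \<and> w \<noteq> 0 \<and> A *v w = c *s w"
proof -
  obtain p where p: "p \<noteq> 0" "poly_act A p v = 0"
    using annihilating_polynomial by blast
  have act: "poly_act A q v \<in> W" for q
    by (induction q) (auto intro: vec.subspace_0[OF W(1)] vec.subspace_add[OF W(1)]
        vec.subspace_scale[OF W(1)] W(2) v(1))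
  show ?thesis using p
  proof (induction "degree p" arbitrary: p)
    case 0
    then obtain a where "p = [:a:]" using degree_eq_zeroE by metis
    then show ?case using 0 v by simp
  next
    case (Suc n)
    then have "\<not> constant (poly p)" by (simp add: constant_degree)
    then obtain c where "poly p c = 0" using fundamental_theorem_of_algebra by blast
    then obtain q where q: "p = [:- c, 1:] * q" by (metis dvdE poly_eq_0_iff_dvd)
    then have "q \<noteq> 0" using Suc by auto
    then have "degree p = Suc (degree q)" unfolding q by (subst degree_mult_eq) auto
    then have n: "n = degree q" using Suc by simp
    have *: "A *v poly_act A q v = c *s poly_act A q v"
      using Suc(4) by (simp add: q poly_act_diff poly_act_smult)
    show ?case
    proof (cases "poly_act A q v = 0")
      case True
      then show ?thesis using Suc(1)[OF n \<open>q \<noteq> 0\<close>] by simp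
    next
      case False
      then show ?thesis using * act by blast
    qed
  qed
qed

text \<open>A unitary matrix preserves \<open>hinner\<close> and has no eigenvalue 0, so the
  orthogonal complement of the eigenvectors already found is invariant and contains another one. The
  induction runs over index sets so that with \<open>T = UNIV\<close> the vectors are directly the
  columns of a square matrix.\<close>

lemma orthonormal_eigenvectors:
  fixes A :: "complex^'n^'n"
  assumes A: "A \<in> unitary_matrices" and "finite (T :: 'n set)"
  shows "\<exists>f d. \<forall>s\<in>T. A *v f s = d s *s f s \<and> (\<forall>t\<in>T. hinner (f s) (f t) = (if s = t then 1 else 0))"
  using assms(2)
proof (induction T)
  case empty
  then show ?case by simp
next
  case (insert x T)
  then obtain f d where f: "\<And>s. s \<in> T \<Longrightarrow> A *v f s = d s *s f s"
      "\<And>s t. s \<in> T \<Longrightarrow> t \<in> T \<Longrightarrow> hinner (f s) (f t) = (if s = t then 1 else 0)"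
    by metis
  define W where "W = {v. \<forall>t\<in>T. hinner (f t) v = 0}"
  have sub: "vec.subspace W"
    by (auto simp: vec.subspace_def W_def hinner_add_right hinner_scale_right)
       (simp add: hinner_def)
  have inv: "A *v w \<in> W" if "w \<in> W" for w
    unfolding W_def
  proof (intro CollectI ballI)
    fix t assume t: "t \<in> T"
    have "cnj (d t) * hinner (f t) (A *v w) = hinner (A *v f t) (A *v w)"
      using f(1)[OF t] by (simp add: hinner_scale_left)
    also have "\<dots> = 0" using that t by (simp add: hinner_unitary[OF A] W_def)
    finally have "d t = 0 \<or> hinner (f t) (A *v w) = 0" by simp
    moreover have "d t \<noteq> 0"
    proof
      assume "d t = 0"
      then have "hinner (A *v f t) (A *v f t) = 0" using f(1)[OF t] by (simp add: hinner_def)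
      then show False using f(2)[OF t t] by (simp add: hinner_unitary[OF A])
    qed
    ultimately show "hinner (f t) (A *v w) = 0" by simp
  qed
  \<comment> \<open>The kernel of \<open>C\<close> is the orthogonal complement of the vectors found
    so far. Its row \<open>x\<close> is zero, so \<open>C\<close> is singular and the complement is
    nontrivial; no dimension of a complex subspace has to be computed.\<close>
  define C :: "complex^'n^'n" where "C = (\<chi> i j. if i \<in> T then cnj (f i $ j) else 0)"
  have "row x C = 0" using insert by (simp add: row_def C_def vec_eq_iff)
  then have "det C = 0" by (rule det_zero_row)
  then have "\<not> (\<exists>B. B ** C = mat 1)"
    by (metis invertible_det_nz invertible_left_inverse)
  then obtain v where v: "C *v v = 0" "v \<noteq> 0" by (auto simp: matrix_left_invertible_ker)
  have "v \<in> W" unfolding W_def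
  proof (intro CollectI ballI)
    fix t assume "t \<in> T"
    have "(C *v v) $ t = 0" using v by simp
    then show "hinner (f t) v = 0" using \<open>t \<in> T\<close> by (simp add: hinner_def C_def matrix_vector_mult_def)
  qed
  then obtain w c where w: "w \<in> W" "w \<noteq> 0" "A *v w = c *s w"
    using invariant_subspace_has_eigenvector[OF sub inv _ v(2)] by blast
  define r where "r = complex_of_real (1 / norm w)"
  define g where "g = (\<lambda>s. if s = x then r *s w else f s)"
  define e where "e = (\<lambda>s. if s = x then c else d s)"
  have "A *v g s = e s *s g s" if "s \<in> insert x T" for s
    using that f(1) w(3) by (auto simp: g_def e_def vector_scalar_commute vector_smult_assoc mult.commute)
  moreover have "hinner (g s) (g t) = (if s = t then 1 else 0)"
    if "s \<in> insert x T" "t \<in> insert x T" for s t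
  proof -
    have 1: "hinner (g x) (g x) = 1"
      using w(2) by (simp add: g_def hinner_scale_left hinner_scale_right r_def) (simp add: hinner_self power2_eq_square)
    have 2: "hinner (g t) (g x) = 0" if "t \<in> T" for t
      using that insert(2) w(1) by (auto simp: g_def hinner_scale_right W_def)
    then have 3: "hinner (g x) (g t) = 0" if "t \<in> T" for t
      using that cnj_hinner[of "g t" "g x"] by simp
    have 4: "hinner (g s) (g t) = (if s = t then 1 else 0)" if "s \<in> T" "t \<in> T" for s t
      using that f(2) insert(2) by (auto simp: g_def)
    show ?thesis using that 1 2 3 4 insert(2) by auto
  qed
  ultimately show ?case by blast
qed

lemma unitary_diagonalizable:
  fixes A :: "complex^'n^'n"
  assumes "A \<in> unitary_matrices"
  obtains V and d :: "'n \<Rightarrow> complex" where "V \<in> unitary_matrices" "A = V ** diag_matrix d ** conj_transpose V"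
proof -
  have "\<exists>f (d :: 'n \<Rightarrow> complex). \<forall>s. A *v f s = d s *s f s \<and> (\<forall>t. hinner (f s) (f t) = (if s = t then 1 else 0))"
    using orthonormal_eigenvectors[OF assms, of UNIV] by simp
  then obtain f and d :: "'n \<Rightarrow> complex" where f: "\<And>s. A *v f s = d s *s f s"
      "\<And>s t. hinner (f s) (f t) = (if s = t then 1 else 0)"
    by blast
  define V where "V = (\<chi> i j. f j $ i)"
  have V: "conj_transpose V ** V = mat 1"
    using f(2) by (simp add: vec_eq_iff matrix_matrix_mult_def V_def hinner_def mat_def)
  have "A ** V = V ** diag_matrix d"
  proof -
    have "(A ** V) $ i $ j = (A *v f j) $ i" for i j
      by (simp add: matrix_matrix_mult_def matrix_vector_mult_def V_def)
    moreover have "(V ** diag_matrix d) $ i $ j = d j * f j $ i" for i j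
      by (simp add: matrix_matrix_mult_def V_def diag_matrix_def if_distrib mult.commute cong: if_cong)
    ultimately show ?thesis using f(1) by (simp add: vec_eq_iff)
  qed
  then have "A ** (V ** conj_transpose V) = V ** diag_matrix d ** conj_transpose V"
    by (simp add: matrix_mul_assoc)
  then have "A = V ** diag_matrix d ** conj_transpose V"
    using V by (simp add: matrix_left_right_inverse)
  then show thesis using that V by (simp add: unitary_matrices_iff)
qed

section \<open>Eigenvalues and multiplicities of a matrix conjugate to a diagonal one\<close>

lemma charpoly_conjugate_diag:
  fixes P Q :: "complex^'n^'n"
  assumes PQ: "P ** Q = mat 1"
  shows "charpoly (P ** diag_matrix d ** Q) = (\<Prod>i\<in>UNIV. [:- d i, 1:])"
proof -
  \<comment> \<open>The embedding of constant matrices into matrices over the polynomial ring is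
    multiplicative, and the scalar matrix of the variable commutes with everything, so the
    characteristic matrix is itself conjugate to a diagonal one.\<close>
  define K :: "complex^'n^'n \<Rightarrow> complex poly^'n^'n" where "K = map_matrix (\<lambda>c. [:c:])"
  have K: "K (A ** B) = K A ** K B" for A B
    by (simp add: K_def vec_eq_iff matrix_matrix_mult_def sum_to_poly mult.commute)
  have K1: "K (mat 1) = mat 1" by (auto simp: K_def vec_eq_iff mat_def)
  have X: "mat x ** B = B ** mat x" for x :: "complex poly" and B :: "complex poly^'n^'n"
    by (simp add: vec_eq_iff matrix_matrix_mult_def mat_def if_distrib if_distribR mult.commute cong: if_cong)
  define X where "X = (mat [:0, 1:] :: complex poly^'n^'n)"
  have "K P ** X ** K Q = X ** (K P ** K Q)" by (simp add: X_def X matrix_mul_assoc)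
  also have "\<dots> = X" using PQ by (simp add: K[symmetric] K1)
  finally have "X - K (P ** diag_matrix d ** Q) = K P ** (X - K (diag_matrix d)) ** K Q"
    by (simp add: K matrix_mul_assoc matrix_diff_ldistrib matrix_diff_rdistrib)
  then have "charpoly (P ** diag_matrix d ** Q) = det (K P ** K Q) * det (X - K (diag_matrix d))"
    by (simp add: charpoly_def det_mul X_def K_def)
  also have "det (K P ** K Q) = 1" using PQ by (simp add: K[symmetric] K1)
  also have "det (X - K (diag_matrix d)) = (\<Prod>i\<in>UNIV. [:- d i, 1:])"
    by (subst det_diagonal) (auto simp: X_def K_def mat_def diag_matrix_def intro!: prod.cong)
  finally show ?thesis by simp
qed

lemma order_prod_linear_factors:
  fixes d :: "'i \<Rightarrow> 'a::idom"
  assumes "finite I"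
  shows "order c (\<Prod>i\<in>I. [:- d i, 1:]) = card {i\<in>I. d i = c}"
  using assms
proof (induction I)
  case empty
  then show ?case by simp
next
  case (insert x I)
  have "order c [:- d x, 1:] = (if d x = c then 1 else 0)"
    using order_power_n_n[of c 1] by (auto intro: order_0I)
  moreover have "[:- d x, 1:] * (\<Prod>i\<in>I. [:- d i, 1:]) \<noteq> 0"
    using insert(1) by (simp add: prod_zero_iff del: mult_pCons_left)
  moreover have "{i \<in> insert x I. d i = c} = (if d x = c then insert x {i\<in>I. d i = c} else {i\<in>I. d i = c})"
    by auto
  ultimately show ?case using insert by (simp add: order_mult del: mult_pCons_left)
qed

lemma eigenvalues_conjugate_diag:
  fixes P Q :: "complex^'n^'n"
  assumes PQ: "P ** Q = mat 1"
  shows "eigenvalues (P ** diag_matrix d ** Q) = range d"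
proof -
  have QP: "Q ** P = mat 1" using PQ by (simp add: matrix_left_right_inverse)
  have D: "(diag_matrix d *v x) $ i = d i * x $ i" for x i
    by (simp add: matrix_vector_mult_def diag_matrix_def if_distrib if_distribR cong: if_cong)
  show ?thesis
  proof (intro equalityI subsetI)
    fix c assume "c \<in> eigenvalues (P ** diag_matrix d ** Q)"
    then obtain v where v: "v \<noteq> 0" "P ** diag_matrix d ** Q *v v = c *s v"
      by (auto simp: eigenvalues_def)
    define w where "w = Q *v v"
    have "diag_matrix d *v w = Q *v (P ** diag_matrix d ** Q *v v)"
      by (simp add: w_def matrix_vector_mul_assoc matrix_mul_assoc QP)
    also have "\<dots> = c *s w" by (simp add: v(2) w_def vector_scalar_commute)
    finally have e: "diag_matrix d *v w = c *s w" .
    have "P *v w = v" by (simp add: w_def matrix_vector_mul_assoc PQ)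
    then have "w \<noteq> 0" using v(1) by auto
    then obtain i where "w $ i \<noteq> 0" by (auto simp: vec_eq_iff)
    then have "d i = c" using arg_cong[OF e, of "\<lambda>x. x $ i"] by (simp add: D)
    then show "c \<in> range d" by blast
  next
    fix c assume "c \<in> range d"
    then obtain i where i: "c = d i" by blast
    define v where "v = P *v axis i 1"
    have Qv: "Q *v v = axis i 1" by (simp add: v_def matrix_vector_mul_assoc QP)
    then have "v \<noteq> 0" by auto
    moreover have "P ** diag_matrix d ** Q *v v = P *v (diag_matrix d *v axis i 1)"
      using Qv by (simp add: matrix_vector_mul_assoc[symmetric])
    moreover have "diag_matrix d *v axis i 1 = c *s axis i 1"
      by (auto simp: vec_eq_iff D i axis_def)
    ultimately show "c \<in> eigenvalues (P ** diag_matrix d ** Q)"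
      by (auto simp: eigenvalues_def v_def vector_scalar_commute)
  qed
qed

text \<open>The conjugating matrices disappear: what remains is the combinatorics of the level sets
  of \<open>d\<close>. All later arguments about multiplicities go through this form.\<close>

lemma has_eigenvalue_multiplicities_conjugate_diag:
  fixes P Q :: "complex^'n^'n"
  assumes "P ** Q = mat 1"
  shows "has_eigenvalue_multiplicities (P ** diag_matrix d ** Q) m k \<longleftrightarrow>
    (\<exists>c. inj_on c {1..m} \<and> range d = c ` {1..m} \<and> (\<forall>i\<in>{1..m}. card {a. d a = c i} = k i))"
  using assms by (simp add: has_eigenvalue_multiplicities_def eigenvalues_conjugate_diag
      multiplicity_of_def charpoly_conjugate_diag order_prod_linear_factors)

section \<open>The tangent model and the unitary group\<close>

text \<open>\<open>r\<close> sends an index to the representative of its block. Across blocks the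
  matrix is skew-Hermitian, and on every block it is an imaginary scalar. For \<open>r = id\<close>
  these are the skew-Hermitian matrices, the Lie algebra of the unitary group, so one model serves
  both dimension counts.\<close>

definition tangent_model :: "('n \<Rightarrow> 'n) \<Rightarrow> (complex^'n^'n) set" where
  "tangent_model r = {s. \<forall>a b. (r a \<noteq> r b \<longrightarrow> s $ a $ b + cnj (s $ b $ a) = 0) \<and>
     (r a = r b \<and> a \<noteq> b \<longrightarrow> s $ a $ b = 0) \<and> s $ r a $ r a = s $ a $ a \<and> Re (s $ a $ a) = 0}"

lemma subspace_tangent_model: "subspace (tangent_model r)"
proof (rule subspaceI)
  show "0 \<in> tangent_model r" by (simp add: tangent_model_def)
next
  fix x y assume xy: "x \<in> tangent_model r" "y \<in> tangent_model r"
  have "x $ a $ b + cnj (x $ b $ a) + (y $ a $ b + cnj (y $ b $ a)) = 0" if "r a \<noteq> r b" for a b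
    using xy that by (simp add: tangent_model_def)
  then show "x + y \<in> tangent_model r"
    using xy by (simp add: tangent_model_def ac_simps)
next
  fix c and x assume x: "x \<in> tangent_model r"
  have "c *\<^sub>R (x $ a $ b + cnj (x $ b $ a)) = 0" if "r a \<noteq> r b" for a b
    using x that by (simp add: tangent_model_def)
  then show "c *\<^sub>R x \<in> tangent_model r"
    using x by (simp add: tangent_model_def scaleR_add_right)
qed

text \<open>A skew-Hermitian matrix \<open>s\<close> is recovered from the real matrix \<open>Re s + Im s\<close>,
  whose first summand is antisymmetric and whose second is symmetric.\<close>

lemma dim_tangent_model:
  fixes r :: "'n::finite \<Rightarrow> 'n"
  assumes idem: "\<And>a. r (r a) = r a"
  shows "dim (tangent_model r) = card {(a, b). r a \<noteq> r b} + card (range r)"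
proof -
  \<comment> \<open>The positions of the free real parameters: all ordered pairs across blocks, and
    for each block the diagonal place of its representative.\<close>
  define J where "J = {(a, b). r a \<noteq> r b} \<union> (\<lambda>a. (a, a)) ` range r"
  define D where "D = (\<lambda>(a, b). axis a (axis b 1) :: real^'n^'n) ` J"
  define T where "T = {x :: real^'n^'n. \<forall>i\<in>Basis. i \<notin> D \<longrightarrow> x \<bullet> i = 0}"
  define \<phi> :: "real^'n^'n \<Rightarrow> complex^'n^'n" where
    "\<phi> = (\<lambda>x. \<chi> a b. if r a \<noteq> r b then Complex (x $ a $ b - x $ b $ a) (x $ a $ b + x $ b $ a)
           else if a = b then Complex 0 (x $ r a $ r a) else 0)"
  have inj: "inj (\<lambda>(a, b). axis a (axis b 1) :: real^'n^'n)"
    by (auto simp: inj_on_def axis_eq_axis)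
  have D: "axis a (axis b 1) \<in> D \<longleftrightarrow> (a, b) \<in> J" for a b
    using inj_image_mem_iff[OF inj, of "(a, b)" J] by (simp add: D_def)
  have T: "x \<in> T \<longleftrightarrow> (\<forall>a b. (a, b) \<notin> J \<longrightarrow> x $ a $ b = 0)" for x
    by (auto simp: T_def Basis_vec_def D inner_axis)
  have "D \<subseteq> Basis" by (auto simp: D_def Basis_vec_def)
  then have "dim T = card D" unfolding T_def by (rule dim_substandard)
  also have "\<dots> = card J" unfolding D_def using inj by (intro card_image) (auto intro: inj_on_subset)
  also have "\<dots> = card {(a, b). r a \<noteq> r b} + card (range r)"
    unfolding J_def by (subst card_Un_disjoint) (auto simp: card_image inj_on_def)
  finally have dimT: "dim T = card {(a, b). r a \<noteq> r b} + card (range r)" .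
  have lin: "linear \<phi>"
    by (rule linearI) (auto simp: \<phi>_def vec_eq_iff complex_eq_iff algebra_simps)
  have sT: "subspace T" unfolding T_def by (rule subspace_substandard)
  have injT: "inj_on \<phi> T"
  proof (rule inj_onI)
    fix x y assume xy: "x \<in> T" "y \<in> T" "\<phi> x = \<phi> y"
    have e: "\<phi> x $ a $ b = \<phi> y $ a $ b" for a b using xy(3) by simp
    have "x $ a $ b = y $ a $ b" for a b
    proof (cases "(a, b) \<in> J")
      case False
      then show ?thesis using xy(1,2) by (simp add: T)
    next
      case True
      then consider "r a \<noteq> r b" | "a = b" "r a = a" using idem by (auto simp: J_def)
      then show ?thesis
      proof cases
        case 1
        then show ?thesis using e[of a b] by (simp add: \<phi>_def)
      next
        case 2
        then show ?thesis using e[of a b] by (simp add: \<phi>_def)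
      qed
    qed
    then show "x = y" by (simp add: vec_eq_iff)
  qed
  have "\<phi> ` T = tangent_model r"
  proof (intro equalityI subsetI)
    fix s assume "s \<in> \<phi> ` T"
    then show "s \<in> tangent_model r"
      by (auto simp: tangent_model_def \<phi>_def complex_eq_iff idem)
  next
    fix s :: "complex^'n^'n" assume s: "s \<in> tangent_model r"
    \<comment> \<open>Across blocks the real and imaginary parts of \<open>\<phi> x $ a $ b\<close>
      add up to twice \<open>x $ a $ b\<close>, hence the halving. On the diagonal only
      representatives carry a value.\<close>
    define x :: "real^'n^'n" where "x = (\<chi> a b. if r a \<noteq> r b then (Re (s $ a $ b) + Im (s $ a $ b)) / 2
        else if a = b \<and> r a = a then Im (s $ a $ a) else 0)"
    have "x $ a $ b = 0" if "(a, b) \<notin> J" for a b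
    proof -
      have "r a = r b" "a = b \<longrightarrow> a \<notin> range r" using that by (auto simp: J_def)
      moreover from this(2) have "\<not> (a = b \<and> r a = a)" by (metis rangeI)
      ultimately show ?thesis by (auto simp: x_def)
    qed
    then have "x \<in> T" by (simp add: T)
    moreover have "\<phi> x $ a $ b = s $ a $ b" for a b
    proof (cases "r a = r b")
      case False
      then have "s $ a $ b + cnj (s $ b $ a) = 0" using s by (simp add: tangent_model_def)
      then show ?thesis using False by (auto simp: \<phi>_def x_def complex_eq_iff field_simps)
    next
      case True
      have "s $ r a $ r a = s $ a $ a" "Re (s $ a $ a) = 0"
        using s by (simp_all add: tangent_model_def)
      moreover have "a \<noteq> b \<Longrightarrow> s $ a $ b = 0"
        using s True by (simp add: tangent_model_def)
      ultimately
      show ?thesis using True idem by (auto simp: \<phi>_def x_def complex_eq_iff)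
    qed
    then have "\<phi> x = s" by (simp add: vec_eq_iff)
    ultimately show "s \<in> \<phi> ` T" by blast
  qed
  then have "dim (tangent_model r) = dim (\<phi> ` T)" by simp
  also have "\<dots> = dim T"
    using injT sT by (intro dim_image_eq[OF lin]) (simp add: span_eq_iff[THEN iffD2])
  finally show ?thesis using dimT by simp
qed

section \<open>Continuity of matrix product, determinant and inverse\<close>

lemma bounded_bilinear_matrix_mult:
  "bounded_bilinear ((**) :: complex^'n^'n \<Rightarrow> complex^'n^'n \<Rightarrow> complex^'n^'n)"
  unfolding bilinear_conv_bounded_bilinear[symmetric] bilinear_def linear_iff
  by (auto simp: vec_eq_iff matrix_matrix_mult_def algebra_simps sum.distrib scaleR_sum_right)

lemmas continuous_on_matrix_mult [continuous_intros] =
  bounded_bilinear.continuous_on[OF bounded_bilinear_matrix_mult]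

lemma continuous_on_det [continuous_intros]:
  fixes f :: "'a::topological_space \<Rightarrow> complex^'n^'n"
  assumes "continuous_on S f"
  shows "continuous_on S (\<lambda>x. det (f x))"
  unfolding det_def using assms
  by (intro continuous_intros continuous_on_prod)

lemma matrix_inv_mult:
  fixes A :: "complex^'n^'n"
  assumes "det A \<noteq> 0"
  shows "A ** matrix_inv A = mat 1" "matrix_inv A ** A = mat 1"
  using someI_ex[of "\<lambda>A'. A ** A' = mat 1 \<and> A' ** A = mat 1"] assms
  by (auto simp: matrix_inv_def invertible_det_nz[symmetric] invertible_def)

text \<open>Cramer's rule applied to each column of the inverse writes its entries as quotients of
  determinants, from which the continuity of inversion is read off.\<close>

lemma matrix_inv_cramer:
  fixes A :: "complex^'n^'n"
  assumes "det A \<noteq> 0"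
  shows "matrix_inv A = (\<chi> i j. det (\<chi> r s. if s = i then mat 1 $ r $ j else A $ r $ s) / det A)"
proof -
  have "matrix_inv A $ i $ j = det (\<chi> r s. if s = i then mat 1 $ r $ j else A $ r $ s) / det A" for i j
  proof -
    have "A *v column j (matrix_inv A) = column j (mat 1)"
      using matrix_inv_mult(1)[OF assms]
      by (simp add: vec_eq_iff column_def matrix_vector_mult_def matrix_matrix_mult_def)
    then have "column j (matrix_inv A) =
        (\<chi> k. det (\<chi> r s. if s = k then column j (mat 1) $ r else A $ r $ s) / det A)"
      by (simp add: cramer[OF assms])
    then show ?thesis by (simp add: vec_eq_iff column_def cong: if_cong)
  qed
  then show ?thesis by (simp add: vec_eq_iff)
qed

lemma continuous_on_matrix_inv:
  fixes f :: "'a::topological_space \<Rightarrow> complex^'n^'n"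
  assumes "continuous_on S f" and nz: "\<And>x. x \<in> S \<Longrightarrow> det (f x) \<noteq> 0"
  shows "continuous_on S (\<lambda>x. matrix_inv (f x))"
proof -
  have "continuous_on S (\<lambda>x. \<chi> i j. det (\<chi> r s. if s = i then mat 1 $ r $ j else f x $ r $ s) / det (f x))"
  proof (intro continuous_on_vec_lambda continuous_on_divide continuous_on_det)
    fix i j r s :: 'n
    show "continuous_on S (\<lambda>x. if s = i then mat 1 $ r $ j else f x $ r $ s)"
      using assms(1) by (cases "s = i") (auto intro!: continuous_intros)
  qed (use assms in auto)
  then show ?thesis
    by (rule continuous_on_eq) (simp add: nz matrix_inv_cramer)
qed

lemma has_real_dimension_unitary_matrices:
  "has_real_dimension (unitary_matrices :: (complex^'n^'n) set) (CARD('n)\<^sup>2)"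
proof (rule has_real_dimension_if_straightened)
  have "mat 1 \<in> (unitary_matrices :: (complex^'n^'n) set)" by (simp add: unitary_matrices_iff)
  then show "(unitary_matrices :: (complex^'n^'n) set) \<noteq> {}" by blast
  fix A :: "complex^'n^'n" assume A: "A \<in> unitary_matrices"
  \<comment> \<open>The matrix \<open>conj_transpose t ** t\<close> is Hermitian, hence the sum of
    one half of itself and the adjoint of that half. Thus the unitarity equation says exactly that
    \<open>t + \<beta> t t\<close> is skew-Hermitian.\<close>
  define \<beta> :: "complex^'n^'n \<Rightarrow> complex^'n^'n \<Rightarrow> complex^'n^'n" where
    "\<beta> = (\<lambda>s t. (1/2) *\<^sub>R (conj_transpose s ** t))"
  have \<beta>: "bounded_bilinear \<beta>"
    unfolding bilinear_conv_bounded_bilinear[symmetric] bilinear_def linear_iff \<beta>_def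
    by (auto simp: vec_eq_iff matrix_matrix_mult_def algebra_simps sum.distrib scaleR_sum_right)
  then obtain \<epsilon> where \<epsilon>: "\<epsilon> > 0" "inj_on (\<lambda>t. t + \<beta> t t) (ball 0 \<epsilon>)"
    using inj_on_add_quadratic by blast
  define \<Theta> where "\<Theta> = (\<lambda>t. A ** (mat 1 + t))"
  have A': "conj_transpose A ** A = mat 1" using A by (simp add: unitary_matrices_iff)
  have "inj_on \<Theta> (ball 0 \<epsilon>)"
  proof (rule inj_onI)
    fix s t assume "\<Theta> s = \<Theta> t"
    then have "conj_transpose A ** \<Theta> s = conj_transpose A ** \<Theta> t" by simp
    then show "s = t" by (simp add: \<Theta>_def matrix_mul_assoc A')
  qed
  moreover have "A = \<Theta> 0" by (simp add: \<Theta>_def)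
  then have "A \<in> \<Theta> ` ball 0 \<epsilon>" using \<epsilon>(1) by (metis centre_in_ball imageI)
  moreover have "\<Theta> t \<in> unitary_matrices \<longleftrightarrow> t + \<beta> t t \<in> tangent_model id" for t
  proof -
    have "conj_transpose (\<Theta> t) ** \<Theta> t = conj_transpose (mat 1 + t) ** (conj_transpose A ** A) ** (mat 1 + t)"
      by (simp add: \<Theta>_def conj_transpose_mult matrix_mul_assoc)
    also have "\<dots> = mat 1 + (t + conj_transpose t + conj_transpose t ** t)"
      by (simp add: A' conj_transpose_add matrix_add_ldistrib matrix_add_rdistrib algebra_simps)
    also have "t + conj_transpose t + conj_transpose t ** t = (t + \<beta> t t) + conj_transpose (t + \<beta> t t)"
      by (simp add: \<beta>_def conj_transpose_add conj_transpose_scaleR conj_transpose_mult algebra_simps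
          flip: scaleR_add_left)
    finally have "\<Theta> t \<in> unitary_matrices \<longleftrightarrow> (t + \<beta> t t) + conj_transpose (t + \<beta> t t) = 0"
      by (simp add: unitary_matrices_iff)
    moreover have "s + conj_transpose s = 0 \<longleftrightarrow> s \<in> tangent_model id" for s :: "complex^'n^'n"
    proof -
      have "s $ a $ b + cnj (s $ b $ a) = 0 \<longleftrightarrow> Re (s $ a $ b) = 0" if "a = b" for a b
        using that by (simp add: complex_eq_iff)
      then show ?thesis unfolding tangent_model_def vec_eq_iff by (simp, metis)
    qed
    ultimately show ?thesis by blast
  qed
  moreover have "dim (tangent_model id :: (complex^'n^'n) set) = CARD('n)\<^sup>2"
  proof -
    have "UNIV - {(a, b :: 'n). a \<noteq> b} = (\<lambda>a. (a, a)) ` UNIV" by auto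
    then have "card (UNIV - {(a, b :: 'n). a \<noteq> b}) = CARD('n)"
      by (simp add: card_image inj_on_def)
    moreover have "card (UNIV - {(a, b :: 'n). a \<noteq> b}) = CARD('n \<times> 'n) - card {(a, b :: 'n). a \<noteq> b}"
      by (rule card_Diff_subset) auto
    moreover have "card {(a, b :: 'n). a \<noteq> b} \<le> CARD('n \<times> 'n)"
      by (rule card_mono) auto
    ultimately show ?thesis
      by (subst dim_tangent_model) (auto simp: power2_eq_square card_prod)
  qed
  moreover have "continuous_on (ball 0 \<epsilon>) \<Theta>"
    unfolding \<Theta>_def by (intro continuous_intros)
  moreover have "continuous_on (ball 0 \<epsilon>) (\<lambda>t. t + \<beta> t t)"
    by (intro continuous_intros bounded_bilinear.continuous_on[OF \<beta>])
  ultimately show "\<exists>N \<Theta> (f :: complex^'n^'n \<Rightarrow> complex^'n^'n) L. open N \<and>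
          continuous_on N \<Theta> \<and> inj_on \<Theta> N \<and> A \<in> \<Theta> ` N \<and>
          continuous_on N f \<and> inj_on f N \<and> subspace L \<and> dim L = CARD('n)\<^sup>2 \<and>
          (\<forall>t\<in>N. \<Theta> t \<in> unitary_matrices \<longleftrightarrow> f t \<in> L)"
    using \<epsilon>(2) subspace_tangent_model
    by (intro exI[of _ "ball 0 \<epsilon>"] exI[of _ \<Theta>] exI[of _ "\<lambda>t. t + \<beta> t t"] exI[of _ "tangent_model id"]) auto
qed

section \<open>Block coordinates near a diagonal matrix\<close>

text \<open>Multiply the unitarity equation of the conjugate by \<open>conj_transpose P\<close> from
  the left and by \<open>P\<close> from the right: the factors \<open>Q\<close> cancel and the Gram
  matrix \<open>G\<close> of the columns of \<open>P\<close> remains. For unimodular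
  \<open>\<mu>\<close> the condition says that columns belonging to different eigenvalues are
  orthogonal.\<close>

lemma unitary_conjugate_diag_iff:
  fixes P Q :: "complex^'n^'n"
  assumes PQ: "P ** Q = mat 1"
  defines "G \<equiv> conj_transpose P ** P"
  shows "P ** diag_matrix \<mu> ** Q \<in> unitary_matrices \<longleftrightarrow>
    (\<forall>a b. cnj (\<mu> a) * G $ a $ b * \<mu> b = G $ a $ b)"
proof -
  define D where "D = diag_matrix \<mu>"
  have QP: "Q ** P = mat 1" using PQ matrix_left_right_inverse by blast
  have PQ': "conj_transpose Q ** conj_transpose P = mat 1"
    using PQ by (simp flip: conj_transpose_mult)
  have QP': "conj_transpose P ** conj_transpose Q = mat 1"
    using QP by (simp flip: conj_transpose_mult)
  have B: "conj_transpose (P ** D ** Q) ** (P ** D ** Q) =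
      conj_transpose Q ** (conj_transpose D ** G ** D) ** Q"
    by (simp add: conj_transpose_mult matrix_mul_assoc G_def)
  have "P ** D ** Q \<in> unitary_matrices \<longleftrightarrow> conj_transpose D ** G ** D = G"
  proof
    assume "P ** D ** Q \<in> unitary_matrices"
    then have "conj_transpose Q ** (conj_transpose D ** G ** D) ** Q = mat 1"
      using B by (simp add: unitary_matrices_iff)
    then have "conj_transpose P ** (conj_transpose Q ** (conj_transpose D ** G ** D) ** Q) ** P = G"
      by (simp add: G_def)
    moreover have "conj_transpose P ** (conj_transpose Q ** M ** Q) ** P
        = (conj_transpose P ** conj_transpose Q) ** M ** (Q ** P)" for M
      by (simp add: matrix_mul_assoc)
    ultimately show "conj_transpose D ** G ** D = G" by (simp add: QP QP')
  next
    assume "conj_transpose D ** G ** D = G"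
    then have "conj_transpose (P ** D ** Q) ** (P ** D ** Q) = conj_transpose Q ** G ** Q"
      using B by simp
    also have "\<dots> = (conj_transpose Q ** conj_transpose P) ** (P ** Q)"
      by (simp add: G_def matrix_mul_assoc)
    finally have "conj_transpose (P ** D ** Q) ** (P ** D ** Q) =
        (conj_transpose Q ** conj_transpose P) ** (P ** Q)" .
    then show "P ** D ** Q \<in> unitary_matrices"
      by (simp add: PQ PQ' unitary_matrices_iff)
  qed
  moreover have "(conj_transpose D ** G ** D) $ a $ b = cnj (\<mu> a) * G $ a $ b * \<mu> b" for a b
    by (simp add: matrix_matrix_mult_def D_def diag_matrix_def if_distrib if_distribR sum.delta
        cong: if_cong)
  ultimately show ?thesis by (simp add: vec_eq_iff D_def)
qed

lemma cnj_mult_self_eq_1_iff: "cnj z * z = 1 \<longleftrightarrow> cmod z = 1"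
proof -
  have "cnj z * z = of_real ((cmod z)\<^sup>2)" by (simp only: complex_norm_square mult.commute)
  then have "cnj z * z = 1 \<longleftrightarrow> (cmod z)\<^sup>2 = 1" by (simp only: of_real_eq_1_iff)
  also have "\<dots> \<longleftrightarrow> cmod z = 1" by (simp only: abs_square_eq_1 abs_norm_cancel)
  finally show ?thesis .
qed

lemma diag_matrix_unitary_iff: "diag_matrix d \<in> unitary_matrices \<longleftrightarrow> (\<forall>a. cmod (d a) = 1)"
proof -
  have "diag_matrix d \<in> unitary_matrices \<longleftrightarrow>
      (\<forall>a b. cnj (d a) * mat 1 $ a $ b * d b = (mat 1 :: complex^'a^'a) $ a $ b)"
    using unitary_conjugate_diag_iff[of "mat 1" "mat 1" d] by simp
  also have "\<dots> \<longleftrightarrow> (\<forall>a. cnj (d a) * d a = 1)" by (auto simp: mat_def)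
  finally show ?thesis by (simp only: cnj_mult_self_eq_1_iff)
qed

text \<open>A diagonal entry is the squared norm of a column of an invertible matrix. Dividing by it
  yields unimodular eigenvalues in the unitarity criterion.\<close>

lemma gram_diagonal_nonzero:
  fixes P Q :: "complex^'n^'n"
  assumes "Q ** P = mat 1"
  shows "(conj_transpose P ** P) $ a $ a \<noteq> 0"
proof
  assume "(conj_transpose P ** P) $ a $ a = 0"
  then have "hinner (column a P) (column a P) = 0"
    by (simp add: hinner_def column_def matrix_matrix_mult_def)
  then have "column a P = 0" by (simp add: hinner_self)
  then have "(Q ** P) $ a $ a = 0" by (simp add: matrix_matrix_mult_def column_def vec_eq_iff)
  then show False using assms by (simp add: mat_def)
qed

lemma finite_maximum_attained:
  fixes f :: "'b \<Rightarrow> real"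
  assumes "finite A" "A \<noteq> {}"
  obtains x where "x \<in> A" "\<And>y. y \<in> A \<Longrightarrow> f y \<le> f x"
proof -
  have "Max (f ` A) \<in> f ` A" using assms by (intro Max_in) auto
  then obtain x where "x \<in> A" "f x = Max (f ` A)" by auto
  moreover have "f y \<le> Max (f ` A)" if "y \<in> A" for y using assms that by (intro Max_ge) auto
  ultimately show thesis using that by metis
qed

lemma norm_sum_le_CARD:
  fixes g :: "'n::finite \<Rightarrow> complex"
  assumes "\<And>c. norm (g c) \<le> B"
  shows "norm (\<Sum>c\<in>UNIV. g c) \<le> real CARD('n) * B"
  using sum_norm_bound[of UNIV g B] assms by simp

lemma sum_mat_1: "(\<Sum>c\<in>UNIV. g c * mat 1 $ c $ b) = (g b :: complex)"
  by (simp add: mat_def if_distrib cong: if_cong)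

lemma sum_mat_1': "(\<Sum>c\<in>UNIV. mat 1 $ b $ c * g c) = (g b :: complex)"
  by (simp add: mat_def if_distribR if_distrib cong: if_cong)

definition off_blocks :: "('n \<Rightarrow> 'n) \<Rightarrow> complex^'n^'n \<Rightarrow> complex^'n^'n" where
  "off_blocks r t = (\<chi> a b. if r a \<noteq> r b then t $ a $ b else 0)"

lemma off_blocks_nth: "off_blocks r t $ a $ b = (if r a \<noteq> r b then t $ a $ b else 0)"
  by (simp add: off_blocks_def)

lemma continuous_on_off_blocks [continuous_intros]:
  "continuous_on S f \<Longrightarrow> continuous_on S (\<lambda>x. off_blocks r (f x))"
  unfolding off_blocks_def
proof (intro continuous_on_vec_lambda)
  fix a b
  assume "continuous_on S f"
  then show "continuous_on S (\<lambda>x. if r a \<noteq> r b then f x $ a $ b else 0)"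
    by (cases "r a = r b") (auto intro!: continuous_intros)
qed

text \<open>Blocks are the level sets of \<open>\<delta>\<close>, named by representatives
  \<open>r a\<close>, and \<open>\<epsilon>\<close> bounds the entries of the perturbation. The
  factor in \<open>gap\<close> is what the estimates cost: they involve two sums, each over all
  indices with terms of relative size at most \<open>\<epsilon>\<close>.\<close>

locale block_chart =
  fixes r :: "'n::finite \<Rightarrow> 'n" and \<delta> :: "'n \<Rightarrow> complex" and \<epsilon> :: real
  assumes r_eq_iff: "r a = r b \<longleftrightarrow> \<delta> a = \<delta> b"
    and r_idem [simp]: "r (r a) = r a"
    and norm_\<delta> [simp]: "cmod (\<delta> a) = 1"
    and \<epsilon>_pos: "0 < \<epsilon>"
    and gap: "\<delta> a \<noteq> \<delta> b \<Longrightarrow> 2 * real CARD('n) * \<epsilon> < cmod (\<delta> a - \<delta> b)"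
begin

definition K where "K t = mat 1 + off_blocks r t"
definition E where "E t = t - off_blocks r t"
text \<open>The perturbation is multiplicative so that, \<open>\<delta> a\<close> being unimodular,
  a perturbed eigenvalue has the modulus of \<open>1 + E t $ a $ a\<close>.\<close>

definition H where "H t = diag_matrix \<delta> ** (mat 1 + E t)"
definition \<Theta> where "\<Theta> t = K t ** H t ** matrix_inv (K t)"
text \<open>Entrywise bounds are used because all estimates compare single entries. The determinant
  condition makes \<open>matrix_inv (K t)\<close> a true inverse and keeps the chart
  continuous.\<close>

definition N where "N = {t. (\<forall>a b. cmod (t $ a $ b) < \<epsilon>) \<and> det (K t) \<noteq> 0}"

lemma \<delta>_nonzero: "\<delta> a \<noteq> 0"
  by (metis norm_\<delta> norm_zero zero_neq_one)

lemma E_nth: "E t $ a $ b = (if r a = r b then t $ a $ b else 0)"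
  by (simp add: E_def off_blocks_nth)

lemma norm_E: "t \<in> N \<Longrightarrow> cmod (E t $ a $ b) < \<epsilon>"
  using \<epsilon>_pos by (simp add: E_nth N_def)

lemma H_nth: "H t $ a $ b = \<delta> a * (mat 1 $ a $ b + E t $ a $ b)"
  by (simp add: H_def matrix_matrix_mult_def diag_matrix_def if_distrib if_distribR cong: if_cong)

lemma K_inv: "t \<in> N \<Longrightarrow> K t ** matrix_inv (K t) = mat 1" "t \<in> N \<Longrightarrow> matrix_inv (K t) ** K t = mat 1"
  by (simp_all add: N_def matrix_inv_mult)

lemma continuous_on_K [continuous_intros]: "continuous_on S K"
  unfolding K_def by (intro continuous_intros)

lemma open_N: "open N"
proof -
  have "N = (\<Inter>a. \<Inter>b. {t. cmod (t $ a $ b) < \<epsilon>}) \<inter> {t. det (K t) \<noteq> 0}"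
    by (auto simp: N_def)
  moreover have "open (\<Inter>a. \<Inter>b. {t :: complex^'n^'n. cmod (t $ a $ b) < \<epsilon>})"
    by (intro open_INT ballI open_Collect_less continuous_intros) auto
  moreover have "open {t. det (K t) \<noteq> 0}"
    by (intro open_Collect_neq continuous_intros)
  ultimately show ?thesis by (metis open_Int)
qed

lemma zero_in_N: "0 \<in> N"
proof -
  have "K 0 = mat 1" by (simp add: K_def vec_eq_iff off_blocks_nth)
  then show ?thesis using \<epsilon>_pos by (simp add: N_def)
qed

lemma \<Theta>_0: "\<Theta> 0 = diag_matrix \<delta>"
proof -
  have 0: "off_blocks r 0 = 0" by (simp add: vec_eq_iff off_blocks_nth)
  have "K 0 ** matrix_inv (K 0) = mat 1" using K_inv zero_in_N by blast
  then show ?thesis by (simp add: \<Theta>_def K_def H_def E_def 0)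
qed

lemma continuous_on_\<Theta>: "continuous_on N \<Theta>"
  unfolding \<Theta>_def H_def E_def
  by (intro continuous_intros continuous_on_matrix_inv) (auto simp: N_def)

text \<open>Compare both sides at an off-block entry of \<open>J\<close> of maximal modulus
  \<open>B\<close>. Since \<open>E s\<close> and \<open>E t\<close> are block-diagonal, only
  off-block entries of \<open>J\<close> meet them there, so the perturbation contributes at most
  \<open>2 * CARD('n) * \<epsilon> * B\<close>, whereas the main term is \<open>B\<close> times a
  difference of two values of \<open>\<delta>\<close>. The gap forces \<open>B = 0\<close>.\<close>

lemma intertwiner_block_diagonal:
  assumes "s \<in> N" "t \<in> N" and J: "J ** H s = H t ** J" and "r a \<noteq> r b"
  shows "J $ a $ b = 0"
proof -
  define Q where "Q = {(a, b). r a \<noteq> r b}"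
  have "finite Q" "Q \<noteq> {}" using assms(4) by (auto simp: Q_def)
  then obtain p where p: "p \<in> Q" "\<And>q. q \<in> Q \<Longrightarrow> cmod (J $ fst q $ snd q) \<le> cmod (J $ fst p $ snd p)"
    using finite_maximum_attained[of Q "\<lambda>q. cmod (J $ fst q $ snd q)"] by blast
  obtain a' b' where p': "p = (a', b')" by (cases p)
  define B where "B = cmod (J $ a' $ b')"
  have ab: "r a' \<noteq> r b'" using p(1) by (simp add: Q_def p')
  have B: "cmod (J $ c $ d) \<le> B" if "r c \<noteq> r d" for c d
    using p(2)[of "(c, d)"] that by (simp add: Q_def p' B_def)
  have 1: "(J ** H s) $ a' $ b' = J $ a' $ b' * \<delta> b' + (\<Sum>c\<in>UNIV. J $ a' $ c * \<delta> c * E s $ c $ b')"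
    by (simp add: matrix_matrix_mult_def H_nth distrib_left sum.distrib sum_mat_1 flip: mult.assoc)
  have 2: "(H t ** J) $ a' $ b' = \<delta> a' * J $ a' $ b' + (\<Sum>c\<in>UNIV. \<delta> a' * E t $ a' $ c * J $ c $ b')"
    by (simp add: matrix_matrix_mult_def H_nth distrib_left distrib_right sum.distrib sum_mat_1' mult.assoc
        flip: sum_distrib_left)
  have b1: "cmod (J $ a' $ c * \<delta> c * E s $ c $ b') \<le> B * \<epsilon>" for c
  proof (cases "r c = r b'")
    case True
    then have "cmod (J $ a' $ c) * cmod (E s $ c $ b') \<le> B * \<epsilon>"
      using B[of a' c] ab norm_E[OF assms(1), of c b'] by (intro mult_mono) (auto simp: B_def)
    then show ?thesis by (simp add: norm_mult)
  qed (use \<epsilon>_pos in \<open>simp add: E_nth B_def\<close>)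
  have b2: "cmod (\<delta> a' * E t $ a' $ c * J $ c $ b') \<le> B * \<epsilon>" for c
  proof (cases "r a' = r c")
    case True
    then have "cmod (E t $ a' $ c) * cmod (J $ c $ b') \<le> \<epsilon> * B"
      using B[of c b'] ab norm_E[OF assms(2), of a' c] \<epsilon>_pos by (intro mult_mono) auto
    then show ?thesis by (simp add: norm_mult mult.commute)
  qed (use \<epsilon>_pos in \<open>simp add: E_nth B_def\<close>)
  have "(\<delta> a' - \<delta> b') * J $ a' $ b' =
      (\<Sum>c\<in>UNIV. J $ a' $ c * \<delta> c * E s $ c $ b') - (\<Sum>c\<in>UNIV. \<delta> a' * E t $ a' $ c * J $ c $ b')"
    using 1 2 J by (simp add: algebra_simps)
  then have "cmod ((\<delta> a' - \<delta> b') * J $ a' $ b') \<le>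
      cmod (\<Sum>c\<in>UNIV. J $ a' $ c * \<delta> c * E s $ c $ b') + cmod (\<Sum>c\<in>UNIV. \<delta> a' * E t $ a' $ c * J $ c $ b')"
    by (simp only: norm_triangle_ineq4)
  also have "\<dots> \<le> real CARD('n) * (B * \<epsilon>) + real CARD('n) * (B * \<epsilon>)"
    using norm_sum_le_CARD[OF b1] norm_sum_le_CARD[OF b2] by (rule add_mono)
  also have "\<dots> = (2 * real CARD('n) * \<epsilon>) * B" by simp
  finally have *: "cmod (\<delta> a' - \<delta> b') * B \<le> (2 * real CARD('n) * \<epsilon>) * B"
    by (simp add: norm_mult B_def)
  have "2 * real CARD('n) * \<epsilon> < cmod (\<delta> a' - \<delta> b')" using gap ab r_eq_iff by blast
  then have "\<not> B > 0" using * mult_strict_right_mono by fastforce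
  then have "cmod (J $ a $ b) \<le> 0" using B[OF assms(4)] by linarith
  then show ?thesis by simp
qed

text \<open>Two preimages are linked by the intertwiner \<open>J\<close>, which is block-diagonal.
  All diagonal blocks of \<open>K s\<close> and \<open>K t\<close> are identities, so comparing the
  diagonal blocks in \<open>K t ** J = K s\<close> gives \<open>J = mat 1\<close>: this
  normalization removes the ambiguity of the conjugating matrix.\<close>

lemma inj_on_\<Theta>: "inj_on \<Theta> N"
proof (rule inj_onI)
  fix s t assume st: "s \<in> N" "t \<in> N" "\<Theta> s = \<Theta> t"
  define J where "J = matrix_inv (K t) ** K s"
  have "J ** H s = matrix_inv (K t) ** (K s ** H s ** matrix_inv (K s)) ** K s"
    by (simp add: J_def K_inv[OF st(1)] flip: matrix_mul_assoc)
  also have "\<dots> = matrix_inv (K t) ** (K t ** H t ** matrix_inv (K t)) ** K s"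
    using st(3) by (simp add: \<Theta>_def)
  also have "\<dots> = H t ** J"
    by (simp add: J_def K_inv[OF st(2)] matrix_mul_assoc)
  finally have J: "J ** H s = H t ** J" .
  have J0: "J $ a $ b = 0" if "r a \<noteq> r b" for a b
    using intertwiner_block_diagonal[OF st(1,2) J that] .
  have KJ: "K t ** J = K s" by (simp add: J_def K_inv[OF st(2)] matrix_mul_assoc)
  have "J $ a $ b = mat 1 $ a $ b" for a b
  proof (cases "r a = r b")
    case True
    have "(K t ** J) $ a $ b = J $ a $ b + (\<Sum>c\<in>UNIV. off_blocks r t $ a $ c * J $ c $ b)"
      by (simp add: matrix_matrix_mult_def K_def distrib_right sum.distrib sum_mat_1')
    also have "(\<Sum>c\<in>UNIV. off_blocks r t $ a $ c * J $ c $ b) = 0"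
      using True J0 by (intro sum.neutral) (auto simp: off_blocks_nth)
    finally show ?thesis using True by (simp add: KJ) (simp add: K_def off_blocks_nth)
  next
    case False
    then show ?thesis using J0 by (auto simp: mat_def)
  qed
  then have J1: "J = mat 1" by (simp add: vec_eq_iff)
  have "off_blocks r s = off_blocks r t" using KJ by (simp add: J1 K_def)
  moreover have "E s = E t" using J \<delta>_nonzero by (simp add: J1 vec_eq_iff H_nth)
  ultimately show "s = t" by (metis E_def diff_add_cancel)
qed

end

section \<open>The stratum in block coordinates\<close>

lemma cmod_one_plus_eq_1_iff: "cmod (1 + z) = 1 \<longleftrightarrow> Re z + Re (cnj z * z) / 2 = 0"
proof -
  have "(cmod (1 + z))\<^sup>2 = 1 + 2 * (Re z + Re (cnj z * z) / 2)"
    unfolding cmod_power2 by (simp add: power2_eq_square algebra_simps)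
  moreover have "cmod (1 + z) = 1 \<longleftrightarrow> (cmod (1 + z))\<^sup>2 = 1\<^sup>2"
    by (rule power2_eq_iff_nonneg[symmetric]) auto
  moreover have "1 + 2 * x = 1\<^sup>2 \<longleftrightarrow> x = 0" for x :: real by simp
  ultimately show ?thesis by metis
qed

context block_chart
begin

text \<open>Half of the quadratic term of the Gram matrix of \<open>K t\<close> across blocks, and
  half of that of \<open>|1 + E|^2\<close> on the diagonal. The latter is read at the
  representative, so all diagonal places of a block receive the same amount and equality of diagonal
  entries in a block is not disturbed.\<close>

definition \<beta> :: "complex^'n^'n \<Rightarrow> complex^'n^'n \<Rightarrow> complex^'n^'n" where
  "\<beta> s t = (1/2) *\<^sub>R (off_blocks r (conj_transpose (off_blocks r s) ** off_blocks r t) +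
     diag_matrix (\<lambda>a. cnj (s $ r a $ r a) * t $ r a $ r a))"

lemma bounded_bilinear_\<beta>: "bounded_bilinear \<beta>"
  unfolding bilinear_conv_bounded_bilinear[symmetric] bilinear_def linear_iff
proof (intro conjI allI)
  fix x y z :: "complex^'n^'n" and c :: real
  have o: "off_blocks r (x + y) = off_blocks r x + off_blocks r y"
      "off_blocks r (c *\<^sub>R x) = c *\<^sub>R off_blocks r x" for x y c
    by (auto simp: vec_eq_iff off_blocks_nth)
  have d: "diag_matrix (\<lambda>a. f a + g a) = diag_matrix f + diag_matrix g"
      "diag_matrix (\<lambda>a. c *\<^sub>R f a) = c *\<^sub>R diag_matrix f" for f g :: "'n \<Rightarrow> complex" and c :: real
    by (auto simp: vec_eq_iff diag_matrix_def)
  show "\<beta> z (x + y) = \<beta> z x + \<beta> z y"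
    by (simp add: \<beta>_def o matrix_add_ldistrib distrib_left d scaleR_add_right)
  show "\<beta> (x + y) z = \<beta> x z + \<beta> y z"
    by (simp add: \<beta>_def o conj_transpose_add matrix_add_rdistrib distrib_right d scaleR_add_right)
  show "\<beta> z (c *\<^sub>R x) = c *\<^sub>R \<beta> z x" "\<beta> (c *\<^sub>R x) z = c *\<^sub>R \<beta> x z"
    by (simp_all add: \<beta>_def o d conj_transpose_scaleR scaleR_add_right scaleR_left_commute
        bounded_bilinear.scaleR_left[OF bounded_bilinear_matrix_mult]
        bounded_bilinear.scaleR_right[OF bounded_bilinear_matrix_mult])
qed

definition straight where
  "straight t \<longleftrightarrow> (\<forall>a b. a \<noteq> b \<longrightarrow> E t $ a $ b = 0) \<and> (\<forall>a. E t $ r a $ r a = E t $ a $ a) \<and>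
     (\<forall>a. cmod (1 + E t $ a $ a) = 1) \<and>
     (\<forall>a b. r a \<noteq> r b \<longrightarrow> (conj_transpose (K t) ** K t) $ a $ b = 0)"

lemma straight_iff: "straight t \<longleftrightarrow> t + \<beta> t t \<in> tangent_model r"
proof -
  define X where "X = off_blocks r t"
  define f where "f = t + \<beta> t t"
  have 1: "f $ a $ b + cnj (f $ b $ a) = (conj_transpose (K t) ** K t) $ a $ b" if "r a \<noteq> r b" for a b
  proof -
    have ne: "a \<noteq> b" using that by auto
    have "conj_transpose (K t) ** K t = mat 1 + X + conj_transpose X + conj_transpose X ** X"
      by (simp add: K_def X_def conj_transpose_add matrix_add_ldistrib matrix_add_rdistrib algebra_simps)
    then have "(conj_transpose (K t) ** K t) $ a $ b =
        t $ a $ b + cnj (t $ b $ a) + (conj_transpose X ** X) $ a $ b"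
      using that ne by (simp add: X_def off_blocks_nth mat_def)
    moreover have "cnj ((conj_transpose X ** X) $ b $ a) = (conj_transpose X ** X) $ a $ b"
      by (simp add: matrix_matrix_mult_def mult.commute)
    ultimately show ?thesis
      using that ne by (simp add: f_def \<beta>_def X_def[symmetric] off_blocks_nth diag_matrix_def
          complex_eq_iff)
  qed
  have 2: "f $ a $ b = E t $ a $ b" if "r a = r b" "a \<noteq> b" for a b
    using that by (simp add: f_def \<beta>_def off_blocks_nth diag_matrix_def E_nth)
  have 3: "f $ a $ a = E t $ a $ a + (1/2) *\<^sub>R (cnj (E t $ r a $ r a) * E t $ r a $ r a)" for a
    by (simp add: f_def \<beta>_def off_blocks_nth diag_matrix_def E_nth)
  have 4: "E t $ a $ b = 0" if "r a \<noteq> r b" for a b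
    using that by (simp add: E_nth)
  have "f $ r a $ r a = f $ a $ a \<longleftrightarrow> E t $ r a $ r a = E t $ a $ a" for a
    by (simp add: 3)
  \<comment> \<open>The correction involves the entry at \<open>r a\<close>, the modulus the entry
    at \<open>a\<close>; they agree only once the diagonal is known to be constant on the
    block.\<close>
  moreover have "Re (f $ a $ a) = 0 \<longleftrightarrow> cmod (1 + E t $ a $ a) = 1"
    if "E t $ r a $ r a = E t $ a $ a" for a
    by (simp add: 3 that cmod_one_plus_eq_1_iff)
  ultimately show ?thesis
    unfolding straight_def tangent_model_def f_def[symmetric] using 1 2 4
    by (simp, metis)
qed

text \<open>Each \<open>\<delta> a\<close> moves by less than \<open>\<epsilon>\<close>, so values
  from different blocks cannot meet across the gap.\<close>

lemma perturbed_eigenvalues_distinct: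
  assumes t: "t \<in> N" and eq: "\<delta> a * (1 + E t $ a $ a) = \<delta> b * (1 + E t $ b $ b)"
  shows "r a = r b"
proof (rule ccontr)
  assume "r a \<noteq> r b"
  then have g: "2 * real CARD('n) * \<epsilon> < cmod (\<delta> a - \<delta> b)" using gap r_eq_iff by blast
  have "\<delta> a - \<delta> b = \<delta> b * E t $ b $ b - \<delta> a * E t $ a $ a"
    using eq by (simp add: algebra_simps)
  then have "cmod (\<delta> a - \<delta> b) \<le> cmod (E t $ b $ b) + cmod (E t $ a $ a)"
    by (metis mult_1 norm_mult norm_triangle_ineq4 norm_\<delta>)
  also have "\<dots> < 2 * \<epsilon>" using norm_E[OF t, of a a] norm_E[OF t, of b b] by simp
  also have "\<dots> \<le> 2 * real CARD('n) * \<epsilon>"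
  proof -
    have "1 \<le> real CARD('n)" by (simp add: Suc_le_eq)
    then show ?thesis using \<epsilon>_pos by simp
  qed
  finally show False using g by simp
qed

text \<open>Here \<open>H t\<close> is diagonal with entries \<open>\<mu>\<close> that are constant
  on blocks and differ between blocks, so \<open>\<mu>\<close> has the level sets of
  \<open>\<delta>\<close> and inherits the multiplicities. For unitarity, inside a block
  \<open>cnj (\<mu> a) * \<mu> b = 1\<close>, and across blocks the Gram entry vanishes.\<close>

lemma straight_imp_stratum:
  assumes t: "t \<in> N" "straight t" and m: "has_eigenvalue_multiplicities (diag_matrix \<delta>) m k"
  shows "\<Theta> t \<in> unitary_matrices" "has_eigenvalue_multiplicities (\<Theta> t) m k"
proof -
  define \<mu> where "\<mu> = (\<lambda>a. \<delta> a * (1 + E t $ a $ a))"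
  have s: "\<And>a b. a \<noteq> b \<Longrightarrow> E t $ a $ b = 0" "\<And>a. E t $ r a $ r a = E t $ a $ a"
      "\<And>a. cmod (1 + E t $ a $ a) = 1"
      "\<And>a b. r a \<noteq> r b \<Longrightarrow> (conj_transpose (K t) ** K t) $ a $ b = 0"
    using t(2) by (simp_all add: straight_def)
  have "H t = diag_matrix \<mu>"
    using s(1) by (auto simp: vec_eq_iff H_nth diag_matrix_def \<mu>_def mat_def)
  then have \<Theta>: "\<Theta> t = K t ** diag_matrix \<mu> ** matrix_inv (K t)" by (simp add: \<Theta>_def)
  have \<mu>1: "\<mu> a = \<mu> b" if "r a = r b" for a b
  proof -
    have "E t $ a $ a = E t $ b $ b" using s(2)[of a] s(2)[of b] that by simp
    then show ?thesis using that r_eq_iff by (simp add: \<mu>_def)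
  qed
  have \<mu>2: "r a = r b" if "\<mu> a = \<mu> b" for a b
    using that unfolding \<mu>_def by (rule perturbed_eigenvalues_distinct[OF t(1)])
  have \<mu>\<delta>: "\<mu> a = \<mu> b \<longleftrightarrow> \<delta> a = \<delta> b" for a b
    using \<mu>1 \<mu>2 r_eq_iff by blast
  have unit: "cnj (\<mu> a) * \<mu> a = 1" for a
    unfolding cnj_mult_self_eq_1_iff by (simp add: \<mu>_def norm_mult s(3))
  have "cnj (\<mu> a) * (conj_transpose (K t) ** K t) $ a $ b * \<mu> b = (conj_transpose (K t) ** K t) $ a $ b" for a b
  proof (cases "r a = r b")
    case True
    then have "cnj (\<mu> a) * \<mu> b = 1" using unit[of a] \<mu>1[of a b] by metis
    moreover have "cnj (\<mu> a) * g * \<mu> b = g * (cnj (\<mu> a) * \<mu> b)" for g by (simp add: mult_ac)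
    ultimately show ?thesis by simp
  qed (simp add: s(4))
  then show "\<Theta> t \<in> unitary_matrices"
    by (simp add: \<Theta> unitary_conjugate_diag_iff[OF K_inv(1)[OF t(1)]])
  have "has_eigenvalue_multiplicities (mat 1 ** diag_matrix \<delta> ** mat 1) m k" using m by simp
  then obtain c where c: "inj_on c {1..m}" "range \<delta> = c ` {1..m}"
      "\<And>i. i \<in> {1..m} \<Longrightarrow> card {a. \<delta> a = c i} = k i"
    by (subst (asm) has_eigenvalue_multiplicities_conjugate_diag) auto
  have "\<exists>a. \<delta> a = c i" if "i \<in> {1..m}" for i
    using that c(2) by (metis imageE imageI)
  then obtain w where w: "\<And>i. i \<in> {1..m} \<Longrightarrow> \<delta> (w i) = c i" by metis
  \<comment> \<open>The new eigenvalues are numbered like the old ones, through an index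
    \<open>w i\<close> at which \<open>\<delta>\<close> takes the value \<open>c i\<close>.\<close>
  define c' where "c' = (\<lambda>i. \<mu> (w i))"
  have c': "\<mu> a = c' i \<longleftrightarrow> \<delta> a = c i" if "i \<in> {1..m}" for a i
    using \<mu>\<delta> w[OF that] by (simp add: c'_def)
  have "inj_on c' {1..m}"
    using c(1) c' w unfolding inj_on_def by (metis c'_def)
  moreover have "range \<mu> = c' ` {1..m}"
  proof (intro equalityI subsetI)
    fix z assume "z \<in> range \<mu>"
    then obtain a where a: "z = \<mu> a" by blast
    then obtain i where "i \<in> {1..m}" "\<delta> a = c i" using c(2) by blast
    then show "z \<in> c' ` {1..m}" using a c' by blast
  qed (auto simp: c'_def)
  moreover have "card {a. \<mu> a = c' i} = k i" if "i \<in> {1..m}" for i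
    using c(3)[OF that] c'[OF that] by simp
  ultimately show "has_eigenvalue_multiplicities (\<Theta> t) m k"
    unfolding \<Theta> has_eigenvalue_multiplicities_conjugate_diag[OF K_inv(1)[OF t(1)]] by blast
qed

text \<open>A Gershgorin estimate inside one block: column \<open>c\<close> of \<open>G\<close>
  satisfies the eigenvalue equation of the block-diagonal matrix \<open>H t\<close>, which is read
  in the row of the block of \<open>a\<close> where the column is largest. It applies to every block
  that the eigenvector meets.\<close>

lemma perturbed_eigenvalue_near:
  assumes t: "t \<in> N" and HG: "H t ** G = G ** diag_matrix \<delta>'" and ac: "G $ a $ c \<noteq> 0"
  shows "cmod (\<delta>' c - \<delta> a) \<le> real CARD('n) * \<epsilon>"
proof -
  obtain x where x: "r x = r a" "\<And>y. r y = r a \<Longrightarrow> cmod (G $ y $ c) \<le> cmod (G $ x $ c)"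
    using finite_maximum_attained[of "{y. r y = r a}" "\<lambda>y. cmod (G $ y $ c)"] by auto
  have "cmod (G $ a $ c) \<le> cmod (G $ x $ c)" using x(2) by simp
  then have pos: "cmod (G $ x $ c) > 0" using ac by (metis zero_less_norm_iff less_le_trans)
  have "\<delta> x = \<delta> a" using x(1) r_eq_iff by simp
  have "(H t ** G) $ x $ c = \<delta> x * G $ x $ c + (\<Sum>b\<in>UNIV. \<delta> x * E t $ x $ b * G $ b $ c)"
    by (simp add: matrix_matrix_mult_def H_nth distrib_left distrib_right sum.distrib sum_mat_1' mult.assoc
        flip: sum_distrib_left)
  moreover have "(G ** diag_matrix \<delta>') $ x $ c = G $ x $ c * \<delta>' c"
    by (simp add: matrix_matrix_mult_def diag_matrix_def if_distrib cong: if_cong)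
  ultimately have "(\<delta>' c - \<delta> a) * G $ x $ c = (\<Sum>b\<in>UNIV. \<delta> x * E t $ x $ b * G $ b $ c)"
    using HG by (simp add: algebra_simps \<open>\<delta> x = \<delta> a\<close>)
  moreover have "cmod (\<delta> x * E t $ x $ b * G $ b $ c) \<le> \<epsilon> * cmod (G $ x $ c)" for b
  proof (cases "r x = r b")
    case True
    then have "cmod (E t $ x $ b) * cmod (G $ b $ c) \<le> \<epsilon> * cmod (G $ x $ c)"
      using x norm_E[OF t, of x b] \<epsilon>_pos by (intro mult_mono) auto
    then show ?thesis by (simp add: norm_mult)
  qed (use \<epsilon>_pos in \<open>simp add: E_nth\<close>)
  ultimately have "cmod (\<delta>' c - \<delta> a) * cmod (G $ x $ c) \<le> real CARD('n) * (\<epsilon> * cmod (G $ x $ c))"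
    using norm_sum_le_CARD by (metis (no_types, lifting) norm_mult)
  then show ?thesis using pos by (simp flip: mult.assoc)
qed

text \<open>Every eigenvalue of the perturbed matrix is close to exactly one \<open>\<delta> a\<close>; as the number of
  distinct eigenvalues is unchanged, each block of \<open>H t\<close> has only one eigenvalue, and being
  diagonalizable it is scalar.\<close>

lemma block_scalar_if_same_number_of_eigenvalues:
  fixes G G' :: "complex^'n^'n"
  assumes t: "t \<in> N" and HG: "H t ** G = G ** diag_matrix \<delta>'" and G: "G ** G' = mat 1"
    and card: "card (range \<delta>') = card (range \<delta>)"
  obtains \<mu> where "H t = diag_matrix \<mu>" "\<And>a b. r a = r b \<Longrightarrow> \<mu> a = \<mu> b"
proof -
  have G': "G' ** G = mat 1" using G matrix_left_right_inverse by blast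
  have row: "\<exists>c. G $ a $ c \<noteq> 0" for a
  proof (rule ccontr)
    assume "\<not> ?thesis"
    then have "(G ** G') $ a $ a = 0" by (simp add: matrix_matrix_mult_def)
    then show False by (simp add: G mat_def)
  qed
  have col: "\<exists>a. G $ a $ c \<noteq> 0" for c
  proof (rule ccontr)
    assume "\<not> ?thesis"
    then have "(G' ** G) $ c $ c = 0" by (simp add: matrix_matrix_mult_def)
    then show False by (simp add: G' mat_def)
  qed
  obtain p where p: "\<And>c. G $ p c $ c \<noteq> 0" using col by metis
  \<comment> \<open>\<open>\<psi>\<close> sends an eigenvalue of \<open>H t\<close> to the value of
    \<open>\<delta>\<close> near it. The chosen column does not matter, since two different values
    of \<open>\<delta>\<close> cannot both lie within \<open>CARD('n) * \<epsilon>\<close> of one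
    eigenvalue.\<close>
  define \<psi> where "\<psi> = (\<lambda>z. \<delta> (p (SOME c. \<delta>' c = z)))"
  have \<psi>: "\<psi> (\<delta>' c) = \<delta> a" if "G $ a $ c \<noteq> 0" for a c
  proof (rule ccontr)
    define c0 where "c0 = (SOME c'. \<delta>' c' = \<delta>' c)"
    have c0: "\<delta>' c0 = \<delta>' c" unfolding c0_def by (rule someI) simp
    assume "\<psi> (\<delta>' c) \<noteq> \<delta> a"
    then have "\<delta> (p c0) \<noteq> \<delta> a" by (simp add: \<psi>_def c0_def)
    then have "2 * real CARD('n) * \<epsilon> < cmod (\<delta> (p c0) - \<delta> a)" using gap by blast
    also have "\<dots> = cmod ((\<delta>' c - \<delta> a) - (\<delta>' c0 - \<delta> (p c0)))" by (simp add: c0)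
    also have "\<dots> \<le> cmod (\<delta>' c - \<delta> a) + cmod (\<delta>' c0 - \<delta> (p c0))" by (rule norm_triangle_ineq4)
    also have "\<dots> \<le> real CARD('n) * \<epsilon> + real CARD('n) * \<epsilon>"
      using perturbed_eigenvalue_near[OF t HG that] perturbed_eigenvalue_near[OF t HG p[of c0]]
      by (rule add_mono)
    finally show False by simp
  qed
  have "\<psi> ` range \<delta>' = range \<delta>"
  proof (intro equalityI subsetI)
    fix z assume "z \<in> \<psi> ` range \<delta>'"
    then obtain c where "z = \<psi> (\<delta>' c)" by blast
    then show "z \<in> range \<delta>" using \<psi>[OF p] by simp
  next
    fix z assume "z \<in> range \<delta>"
    then obtain a where "z = \<delta> a" by blast
    moreover obtain c where "G $ a $ c \<noteq> 0" using row by blast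
    ultimately show "z \<in> \<psi> ` range \<delta>'" using \<psi> by (metis rangeI imageI)
  qed
  \<comment> \<open>A surjection between finite sets of equal size is injective, so no block can
    contain two eigenvalues.\<close>
  then have inj: "inj_on \<psi> (range \<delta>')" using card by (intro eq_card_imp_inj_on) auto
  have same: "\<delta>' c = \<delta>' c'" if "G $ a $ c \<noteq> 0" "G $ a' $ c' \<noteq> 0" "r a = r a'" for a a' c c'
    using inj \<psi>[OF that(1)] \<psi>[OF that(2)] that(3) r_eq_iff by (auto simp: inj_on_def)
  obtain q where q: "\<And>a. G $ a $ q a \<noteq> 0" using row by metis
  define \<mu> where "\<mu> = (\<lambda>a. \<delta>' (q a))"
  have "(G ** diag_matrix \<delta>') $ a $ c = (diag_matrix \<mu> ** G) $ a $ c" for a c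
  proof -
    have "(G ** diag_matrix \<delta>') $ a $ c = G $ a $ c * \<delta>' c"
      by (simp add: matrix_matrix_mult_def diag_matrix_def if_distrib cong: if_cong)
    also have "\<dots> = \<mu> a * G $ a $ c"
      using same[OF _ q[of a], of a c] by (cases "G $ a $ c = 0") (auto simp: \<mu>_def)
    also have "\<dots> = (diag_matrix \<mu> ** G) $ a $ c"
      by (simp add: matrix_matrix_mult_def diag_matrix_def if_distrib if_distribR cong: if_cong)
    finally show ?thesis .
  qed
  then have "H t ** G = diag_matrix \<mu> ** G" using HG by (simp add: vec_eq_iff)
  then have "H t ** (G ** G') = diag_matrix \<mu> ** (G ** G')" by (metis matrix_mul_assoc)
  then have "H t = diag_matrix \<mu>" by (simp add: G)
  moreover have "\<mu> a = \<mu> b" if "r a = r b" for a b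
    using same[OF q q that] by (simp add: \<mu>_def)
  ultimately show thesis using that by blast
qed

lemma stratum_imp_straight:
  assumes t: "t \<in> N" and U: "\<Theta> t \<in> unitary_matrices" and m: "has_eigenvalue_multiplicities (\<Theta> t) m k"
    and m\<delta>: "has_eigenvalue_multiplicities (diag_matrix \<delta>) m k"
  shows "straight t"
proof -
  obtain V \<delta>' where V: "V \<in> unitary_matrices" "\<Theta> t = V ** diag_matrix \<delta>' ** conj_transpose V"
    using unitary_diagonalizable[OF U] .
  have VV: "V ** conj_transpose V = mat 1" "conj_transpose V ** V = mat 1"
    using V(1) by (simp add: unitary_matrices_def) (use V(1) in \<open>simp add: unitary_matrices_iff\<close>)
  have cardm: "card (range d) = m"
    if "has_eigenvalue_multiplicities (P ** diag_matrix d ** Q) m k" "P ** Q = mat 1"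
    for P Q :: "complex^'n^'n" and d :: "'n \<Rightarrow> complex"
    using that(1) unfolding has_eigenvalue_multiplicities_conjugate_diag[OF that(2)]
    by (auto simp: card_image)
  have card: "card (range \<delta>') = card (range \<delta>)"
    using cardm[of V \<delta>' "conj_transpose V"] cardm[of "mat 1" \<delta> "mat 1"] m m\<delta> VV V(2) by simp
  \<comment> \<open>An eigenbasis of the unitary matrix \<open>\<Theta> t\<close>, pulled back by
    \<open>K t\<close>, is an eigenbasis of \<open>H t\<close>.\<close>
  define G where "G = matrix_inv (K t) ** V"
  have "H t ** G = (matrix_inv (K t) ** K t) ** H t ** matrix_inv (K t) ** V"
    by (simp add: G_def K_inv[OF t] matrix_mul_assoc)
  also have "\<dots> = matrix_inv (K t) ** \<Theta> t ** V"
    by (simp add: \<Theta>_def matrix_mul_assoc)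
  also have "\<dots> = matrix_inv (K t) ** V ** diag_matrix \<delta>' ** (conj_transpose V ** V)"
    by (simp add: V(2) matrix_mul_assoc)
  finally have HG: "H t ** G = G ** diag_matrix \<delta>'" by (simp add: VV G_def)
  have "G ** (conj_transpose V ** K t) = matrix_inv (K t) ** (V ** conj_transpose V) ** K t"
    by (simp add: G_def matrix_mul_assoc)
  then have GG: "G ** (conj_transpose V ** K t) = mat 1" by (simp add: VV K_inv[OF t])
  obtain \<mu> where \<mu>: "H t = diag_matrix \<mu>" "\<And>a b. r a = r b \<Longrightarrow> \<mu> a = \<mu> b"
    using block_scalar_if_same_number_of_eigenvalues[OF t HG GG card] by blast
  have e: "\<delta> a * (mat 1 $ a $ b + E t $ a $ b) = (if a = b then \<mu> a else 0)" for a b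
    using arg_cong[OF \<mu>(1), of "\<lambda>M. M $ a $ b"] by (simp add: H_nth diag_matrix_def)
  have E0: "E t $ a $ b = 0" if "a \<noteq> b" for a b
    using e[of a b] that \<delta>_nonzero by (simp add: mat_def)
  have \<mu>e: "\<mu> a = \<delta> a * (1 + E t $ a $ a)" for a using e[of a a] by (simp add: mat_def)
  have Er: "E t $ r a $ r a = E t $ a $ a" for a
  proof -
    have "\<delta> (r a) = \<delta> a" "\<mu> (r a) = \<mu> a" using r_eq_iff[of "r a" a] \<mu>(2)[of "r a" a] by simp_all
    then show ?thesis using \<delta>_nonzero[of a] by (simp add: \<mu>e)
  qed
  define F where "F = conj_transpose (K t) ** K t"
  have F: "cnj (\<mu> a) * F $ a $ b * \<mu> b = F $ a $ b" for a b
    using U unfolding \<Theta>_def \<mu>(1) unitary_conjugate_diag_iff[OF K_inv(1)[OF t]] F_def by blast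
  have c1: "cnj (\<mu> a) * \<mu> a = 1" for a
    using F[of a a] gram_diagonal_nonzero[OF K_inv(2)[OF t], of a] by (simp add: F_def mult_ac)
  then have "cmod (\<mu> a) = 1" for a by (simp only: cnj_mult_self_eq_1_iff)
  then have "cmod (1 + E t $ a $ a) = 1" for a by (simp add: \<mu>e norm_mult)
  moreover have "F $ a $ b = 0" if "r a \<noteq> r b" for a b
  proof (rule ccontr)
    assume "F $ a $ b \<noteq> 0"
    then have "cnj (\<mu> a) * \<mu> b = 1" using F[of a b] by (simp add: mult_ac)
    then have "\<mu> a * (cnj (\<mu> a) * \<mu> b) = \<mu> a" by simp
    moreover have "\<mu> a * (cnj (\<mu> a) * \<mu> b) = (cnj (\<mu> a) * \<mu> a) * \<mu> b" by (simp only: mult_ac)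
    ultimately have "\<mu> b = \<mu> a" by (simp add: c1)
    then show False using perturbed_eigenvalues_distinct[OF t] that by (metis \<mu>e)
  qed
  ultimately show ?thesis using E0 Er by (simp add: straight_def F_def)
qed

end

section \<open>Dimension of the stratum\<close>

definition stratum :: "nat \<Rightarrow> (nat \<Rightarrow> nat) \<Rightarrow> (complex^'n^'n) set" where
  "stratum m k = {A \<in> unitary_matrices. has_eigenvalue_multiplicities A m k}"

text \<open>Conjugation changes only the diagonalizing matrix and keeps the diagonal, so a chart at
  a diagonal matrix can be carried to any point of the stratum.\<close>

lemma stratum_conjugate:
  assumes V: "V \<in> unitary_matrices" and A: "A \<in> stratum m k"
  shows "V ** A ** conj_transpose V \<in> stratum m k"
proof -
  have U: "A \<in> unitary_matrices" using A by (simp add: stratum_def)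
  obtain W d where W: "W \<in> unitary_matrices" "A = W ** diag_matrix d ** conj_transpose W"
    using unitary_diagonalizable[OF U] .
  have eq: "V ** A ** conj_transpose V = (V ** W) ** diag_matrix d ** conj_transpose (V ** W)"
    by (simp add: W(2) conj_transpose_mult matrix_mul_assoc)
  have W1: "W ** conj_transpose W = mat 1" using W(1) by (simp add: unitary_matrices_def)
  have VW: "(V ** W) ** conj_transpose (V ** W) = mat 1"
    using unitary_matrices_mult[OF V W(1)] by (simp add: unitary_matrices_def)
  have "has_eigenvalue_multiplicities (V ** A ** conj_transpose V) m k"
    unfolding eq has_eigenvalue_multiplicities_conjugate_diag[OF VW]
    using A unfolding stratum_def W(2) mem_Collect_eq has_eigenvalue_multiplicities_conjugate_diag[OF W1]
    by blast
  then show ?thesis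
    by (simp add: stratum_def unitary_matrices_mult unitary_matrices_conj_transpose V U)
qed

lemma stratum_conjugate_iff:
  assumes V: "V \<in> unitary_matrices"
  shows "V ** A ** conj_transpose V \<in> stratum m k \<longleftrightarrow> A \<in> stratum m k"
proof
  assume "V ** A ** conj_transpose V \<in> stratum m k"
  from stratum_conjugate[OF unitary_matrices_conj_transpose[OF V] this]
  have "(conj_transpose V ** V) ** A ** (conj_transpose V ** V) \<in> stratum m k"
    by (simp add: matrix_mul_assoc)
  then show "A \<in> stratum m k" using V by (simp add: unitary_matrices_iff)
qed (rule stratum_conjugate[OF V])

lemma stratum_nonempty:
  fixes k :: "nat \<Rightarrow> nat"
  assumes pos: "\<And>i. i \<in> {1..m} \<Longrightarrow> 0 < k i" and sum: "(\<Sum>i=1..m. k i) = CARD('n::finite)"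
  shows "(stratum m k :: (complex^'n^'n) set) \<noteq> {}"
proof -
  define P where "P = (SIGMA i:{1..m}. {..<k i})"
  have "card P = CARD('n)" using sum by (simp add: P_def)
  moreover have "finite P" by (simp add: P_def)
  ultimately obtain h where h: "bij_betw h (UNIV :: 'n set) P"
    using finite_same_card_bij[of "UNIV :: 'n set" P] by auto
  define g where "g = fst \<circ> h"
  have gcard: "card {a. g a = i} = k i" if "i \<in> {1..m}" for i
  proof -
    have "bij_betw h {a. g a = i} ({i} \<times> {..<k i})"
      unfolding bij_betw_def
    proof
      show "inj_on h {a. g a = i}" using h by (auto simp: bij_betw_def inj_on_def)
      have "P = range h" using h by (simp add: bij_betw_def)
      moreover have "{i} \<times> {..<k i} = {p \<in> P. fst p = i}" using that by (auto simp: P_def)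
      moreover have "h ` {a. g a = i} = {p \<in> range h. fst p = i}" by (auto simp: g_def)
      ultimately show "h ` {a. g a = i} = {i} \<times> {..<k i}" by simp
    qed
    then show ?thesis using bij_betw_same_card by fastforce
  qed
  have grange: "range g = {1..m}"
  proof (intro equalityI subsetI)
    fix i assume "i \<in> range g"
    then obtain a where "i = fst (h a)" by (auto simp: g_def)
    moreover have "h a \<in> P" using h by (auto simp: bij_betw_def)
    ultimately show "i \<in> {1..m}" by (auto simp: P_def)
  next
    fix i assume "i \<in> {1..m}"
    then have "card {a. g a = i} \<noteq> 0" using gcard pos by simp
    then have "{a. g a = i} \<noteq> {}" by (metis card.empty)
    then show "i \<in> range g" by blast
  qed
  \<comment> \<open>The angles lie between 0 and \<open>pi\<close>, where the cosine alone already
    separates them.\<close>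
  define c where "c = (\<lambda>i::nat. cis (1 / real i))"
  have inj: "inj_on c {1..m}"
  proof (rule inj_onI)
    fix i j assume ij: "i \<in> {1..m}" "j \<in> {1..m}" "c i = c j"
    have b: "0 \<le> 1 / real i \<and> 1 / real i \<le> pi" if "i \<in> {1..m}" for i
    proof -
      have "1 / real i \<le> 1" using that by simp
      then show ?thesis using pi_gt3 by simp
    qed
    have "cos (1 / real i) = cos (1 / real j)"
      using ij(3) by (simp add: c_def complex_eq_iff)
    then have "1 / real i = 1 / real j" using b[OF ij(1)] b[OF ij(2)] cos_inj_pi by blast
    then show "i = j" by simp
  qed
  define d where "d = (\<lambda>a. c (g a))"
  have "range d = c ` {1..m}" unfolding d_def grange[symmetric] by auto
  moreover have "card {a. d a = c i} = k i" if "i \<in> {1..m}" for i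
  proof -
    have "{a. d a = c i} = {a. g a = i}"
      using inj that grange unfolding d_def inj_on_def by blast
    then show ?thesis using gcard that by simp
  qed
  ultimately have "has_eigenvalue_multiplicities (mat 1 ** diag_matrix d ** mat 1) m k"
    using inj by (subst has_eigenvalue_multiplicities_conjugate_diag) auto
  moreover have "diag_matrix d \<in> unitary_matrices"
    by (simp add: diag_matrix_unitary_iff d_def c_def)
  ultimately show ?thesis unfolding stratum_def by auto
qed

text \<open>Pairs of indices with equal values form the disjoint union of the squares of the level
  sets. The additive form avoids truncated subtraction.\<close>

lemma card_block_pairs:
  fixes d :: "'n::finite \<Rightarrow> 'c" and c :: "nat \<Rightarrow> 'c"
  assumes "inj_on c {1..m}" "range d = c ` {1..m}" "\<And>i. i \<in> {1..m} \<Longrightarrow> card {a. d a = c i} = k i"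
  shows "card {(a, b). d a \<noteq> d b} + (\<Sum>i=1..m. (k i)\<^sup>2) = CARD('n)\<^sup>2"
proof -
  define B where "B = (\<lambda>i. {a. d a = c i} \<times> {a. d a = c i})"
  have "{(a, b). d a = d b} = (\<Union>i\<in>{1..m}. B i)"
  proof (intro equalityI subsetI)
    fix p assume "p \<in> {(a, b). d a = d b}"
    then obtain a b where p: "p = (a, b)" "d a = d b" by auto
    obtain i where "i \<in> {1..m}" "d a = c i" using assms(2) by blast
    then show "p \<in> (\<Union>i\<in>{1..m}. B i)" using p by (auto simp: B_def)
  qed (auto simp: B_def)
  then have "card {(a, b). d a = d b} = card (\<Union>i\<in>{1..m}. B i)" by simp
  also have "\<dots> = (\<Sum>i\<in>{1..m}. card (B i))"
  proof (intro card_UN_disjoint ballI impI)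
    fix i j assume "i \<in> {1..m}" "j \<in> {1..m}" "i \<noteq> j"
    then have "c i \<noteq> c j" using assms(1) by (meson inj_onD)
    then show "B i \<inter> B j = {}" by (auto simp: B_def)
  qed (simp_all add: B_def)
  also have "\<dots> = (\<Sum>i=1..m. (k i)\<^sup>2)"
    using assms(3) by (intro sum.cong) (auto simp: B_def card_cartesian_product power2_eq_square)
  finally have 1: "card {(a, b). d a = d b} = (\<Sum>i=1..m. (k i)\<^sup>2)" .
  have "card ({(a, b). d a \<noteq> d b} \<union> {(a, b). d a = d b}) =
      card {(a, b). d a \<noteq> d b} + card {(a, b). d a = d b}"
    by (rule card_Un_disjoint) auto
  moreover have "{(a, b). d a \<noteq> d b} \<union> {(a, b). d a = d b} = (UNIV :: ('n \<times> 'n) set)" by auto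
  ultimately show ?thesis using 1 by (simp add: card_prod power2_eq_square)
qed

lemma block_chart_exists:
  fixes \<delta> :: "'n::finite \<Rightarrow> complex"
  assumes unit: "\<And>a. cmod (\<delta> a) = 1"
  obtains r \<epsilon> where "block_chart r \<delta> \<epsilon>"
proof -
  define r where "r = (\<lambda>a. SOME b. \<delta> b = \<delta> a)"
  have r: "\<delta> (r a) = \<delta> a" for a unfolding r_def by (rule someI[of _ a]) simp
  have r2: "r a = r b \<longleftrightarrow> \<delta> a = \<delta> b" for a b
  proof
    show "\<delta> a = \<delta> b \<Longrightarrow> r a = r b" by (simp add: r_def)
  qed (metis r)
  \<comment> \<open>The extra element 1 keeps the set nonempty when \<open>\<delta>\<close> is
    constant.\<close>
  define G where "G = insert 1 {cmod (\<delta> a - \<delta> b) | a b. \<delta> a \<noteq> \<delta> b}"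
  have "{cmod (\<delta> a - \<delta> b) | a b. \<delta> a \<noteq> \<delta> b} \<subseteq> (\<lambda>(a, b). cmod (\<delta> a - \<delta> b)) ` UNIV" by auto
  then have fin: "finite G" unfolding G_def by (simp add: finite_subset)
  have "Min G \<in> G" using fin by (intro Min_in) (auto simp: G_def)
  then have pos: "Min G > 0" by (auto simp: G_def)
  \<comment> \<open>The 4 makes the required separation half of the minimal gap, so that the
    inequality is strict.\<close>
  define \<epsilon> where "\<epsilon> = Min G / (4 * real CARD('n))"
  have e: "2 * real CARD('n) * \<epsilon> = Min G / 2" by (simp add: \<epsilon>_def)
  have "block_chart r \<delta> \<epsilon>"
  proof
    show "r a = r b \<longleftrightarrow> \<delta> a = \<delta> b" for a b by (rule r2)
    show "r (r a) = r a" for a using r2 r by blast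
    show "cmod (\<delta> a) = 1" for a by (rule unit)
    show "0 < \<epsilon>" using pos by (simp add: \<epsilon>_def)
    show "2 * real CARD('n) * \<epsilon> < cmod (\<delta> a - \<delta> b)" if "\<delta> a \<noteq> \<delta> b" for a b
    proof -
      have "Min G \<le> cmod (\<delta> a - \<delta> b)" using fin that by (intro Min_le) (auto simp: G_def)
      then show ?thesis using pos by (simp add: e)
    qed
  qed
  then show thesis by (rule that)
qed

lemma has_real_dimension_stratum:
  fixes k :: "nat \<Rightarrow> nat"
  assumes pos: "\<And>i. i \<in> {1..m} \<Longrightarrow> 0 < k i" and sum: "(\<Sum>i=1..m. k i) = CARD('n::finite)"
  shows "has_real_dimension (stratum m k :: (complex^'n^'n) set) (CARD('n)\<^sup>2 - (\<Sum>i=1..m. (k i)\<^sup>2) + m)"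
proof (rule has_real_dimension_if_straightened)
  show "(stratum m k :: (complex^'n^'n) set) \<noteq> {}" using stratum_nonempty[OF assms] .
  fix A :: "complex^'n^'n" assume A: "A \<in> stratum m k"
  then have "A \<in> unitary_matrices" by (simp add: stratum_def)
  then obtain V \<delta> where V: "V \<in> unitary_matrices" and AV: "A = V ** diag_matrix \<delta> ** conj_transpose V"
    using unitary_diagonalizable by blast
  have VV: "conj_transpose V ** V = mat 1" using V by (simp add: unitary_matrices_iff)
  have D: "diag_matrix \<delta> \<in> stratum m k"
    using A unfolding AV by (simp add: stratum_conjugate_iff[OF V])
  then have m\<delta>: "has_eigenvalue_multiplicities (diag_matrix \<delta>) m k" by (simp add: stratum_def)
  have "cmod (\<delta> a) = 1" for a using D by (simp add: stratum_def diag_matrix_unitary_iff)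
  then obtain r \<epsilon> where "block_chart r \<delta> \<epsilon>" using block_chart_exists by blast
  then interpret block_chart r \<delta> \<epsilon> .
  obtain \<eta> where \<eta>: "\<eta> > 0" "inj_on (\<lambda>t. t + \<beta> t t) (ball 0 \<eta>)"
    using inj_on_add_quadratic[OF bounded_bilinear_\<beta>] by blast
  define N' where "N' = N \<inter> ball 0 \<eta>"
  define \<Phi> where "\<Phi> = (\<lambda>t. V ** \<Theta> t ** conj_transpose V)"
  have sub: "N' \<subseteq> N" by (simp add: N'_def)
  have inj: "inj_on \<Phi> N'"
  proof (rule inj_onI)
    fix s t assume st: "s \<in> N'" "t \<in> N'" "\<Phi> s = \<Phi> t"
    have "conj_transpose V ** \<Phi> x ** V = (conj_transpose V ** V) ** \<Theta> x ** (conj_transpose V ** V)" for x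
      by (simp add: \<Phi>_def matrix_mul_assoc)
    then have "conj_transpose V ** \<Phi> x ** V = \<Theta> x" for x by (simp add: VV)
    then have "\<Theta> s = \<Theta> t" using st(3) by metis
    then show "s = t" using inj_on_\<Theta> st(1,2) sub by (auto simp: inj_on_def)
  qed
  have cont: "continuous_on N' \<Phi>"
    unfolding \<Phi>_def by (intro continuous_intros continuous_on_subset[OF continuous_on_\<Theta> sub])
  have contf: "continuous_on N' (\<lambda>t. t + \<beta> t t)"
    by (intro continuous_intros bounded_bilinear.continuous_on[OF bounded_bilinear_\<beta>])
  have in_image: "A \<in> \<Phi> ` N'"
  proof
    show "A = \<Phi> 0" by (simp add: AV \<Phi>_def \<Theta>_0)
    show "0 \<in> N'" using zero_in_N \<eta>(1) by (simp add: N'_def)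
  qed
  have iff: "\<Phi> t \<in> stratum m k \<longleftrightarrow> t + \<beta> t t \<in> tangent_model r" if "t \<in> N'" for t
  proof -
    have t: "t \<in> N" using that sub by blast
    have "\<Phi> t \<in> stratum m k \<longleftrightarrow> \<Theta> t \<in> stratum m k" unfolding \<Phi>_def by (rule stratum_conjugate_iff[OF V])
    also have "\<dots> \<longleftrightarrow> straight t"
      using straight_imp_stratum[OF t _ m\<delta>] stratum_imp_straight[OF t _ _ m\<delta>]
      by (auto simp: stratum_def)
    finally show ?thesis by (simp add: straight_iff)
  qed
  have dim: "dim (tangent_model r) = CARD('n)\<^sup>2 - (\<Sum>i=1..m. (k i)\<^sup>2) + m"
  proof -
    have "has_eigenvalue_multiplicities (mat 1 ** diag_matrix \<delta> ** mat 1) m k" using m\<delta> by simp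
    then obtain c where c: "inj_on c {1..m}" "range \<delta> = c ` {1..m}"
        "\<And>i. i \<in> {1..m} \<Longrightarrow> card {a. \<delta> a = c i} = k i"
      by (subst (asm) has_eigenvalue_multiplicities_conjugate_diag) auto
    have "card (\<delta> ` range r) = card (range r)"
      by (rule card_image) (auto simp: inj_on_def simp flip: r_eq_iff)
    moreover have "\<delta> (r a) = \<delta> a" for a using r_eq_iff[of "r a" a] by simp
    then have "\<delta> ` range r = range \<delta>" by (auto simp: image_image)
    moreover have "card (range \<delta>) = m" using c by (simp add: card_image)
    ultimately have "card (range r) = m" by simp
    moreover have "{(a, b). r a \<noteq> r b} = {(a, b). \<delta> a \<noteq> \<delta> b}" by (simp add: r_eq_iff)
    ultimately show ?thesis
      using card_block_pairs[OF c] by (subst dim_tangent_model) auto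
  qed
  have "open N'" using open_N by (simp add: N'_def open_Int)
  moreover have "inj_on (\<lambda>t. t + \<beta> t t) N'"
    using \<eta>(2) by (rule inj_on_subset) (simp add: N'_def)
  ultimately show "\<exists>N \<Theta> (f :: complex^'n^'n \<Rightarrow> complex^'n^'n) L. open N \<and>
          continuous_on N \<Theta> \<and> inj_on \<Theta> N \<and> A \<in> \<Theta> ` N \<and>
          continuous_on N f \<and> inj_on f N \<and> subspace L \<and> dim L = CARD('n)\<^sup>2 - (\<Sum>i=1..m. (k i)\<^sup>2) + m \<and>
          (\<forall>t\<in>N. \<Theta> t \<in> stratum m k \<longleftrightarrow> f t \<in> L)"
    using inj cont contf in_image iff dim subspace_tangent_model by blast
qed

theorem theorem4:
  fixes m :: nat and k :: "nat \<Rightarrow> nat"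
  assumes "\<And>i. i \<in> {1..m} \<Longrightarrow> 0 < k i"
    and "(\<Sum>i=1..m. k i) = CARD('n::finite)"
  shows "has_real_codimension_in
           {A \<in> (unitary_matrices :: (complex^'n^'n) set). has_eigenvalue_multiplicities A m k}
           unitary_matrices
           (\<Sum>i=1..m. ((int (k i))\<^sup>2 - 1))"
proof -
  \<comment> \<open>This makes the subtraction of natural numbers in the dimension of the stratum an
    honest one, so it may be passed to the integers.\<close>
  have "(\<Sum>i=1..m. (k i)\<^sup>2) \<le> (\<Sum>i=1..m. k i)\<^sup>2"
  proof -
    have "k i * k i \<le> k i * (\<Sum>j=1..m. k j)" if "i \<in> {1..m}" for i
      using that by (intro mult_left_mono member_le_sum) auto
    then show ?thesis unfolding power2_eq_square sum_distrib_right by (rule sum_mono)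
  qed
  then have "(\<Sum>i=1..m. ((int (k i))\<^sup>2 - 1)) =
      int (CARD('n)\<^sup>2) - int (CARD('n)\<^sup>2 - (\<Sum>i=1..m. (k i)\<^sup>2) + m)"
    unfolding assms(2) by (simp add: sum_subtractf of_nat_diff)
  moreover have "has_real_dimension
      {A \<in> (unitary_matrices :: (complex^'n^'n) set). has_eigenvalue_multiplicities A m k}
      (CARD('n)\<^sup>2 - (\<Sum>i=1..m. (k i)\<^sup>2) + m)"
    using has_real_dimension_stratum[of m k, OF assms] unfolding stratum_def .
  ultimately show ?thesis
    unfolding has_real_codimension_in_def
    using has_real_dimension_unitary_matrices by blast
qed

end
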